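(* Let $q$ be a power of a prime $p$, $K$ an algebraic closure of $\mathbb{F}_q$, and $\overline{\mathrm{AGL}}(2,q)$ the stabilizer in $\mathrm{PGL}(3,q)$ of a point of $\mathrm{PG}(2,q)$, acting on $\mathrm{PG}(2,K)$. Then $\varepsilon(\overline{\mathrm{AGL}}(2,q))=q^2-q$.
   Context: Plane curves are projective plane curves over $K$; irreducible means irreducible over $K$; $G$-invariant means mapped onto itself by every element of $G$. $d(G)$ is the smallest degree of a $G$-invariant irreducible plane curve other than a line; $\varepsilon(G)=d'(G)-d(G)$, where $d'(G)$ is the smallest degree larger than $d(G)$ of a $G$-invariant irreducible plane curve (the first gap in the degree spectrum). Here $d(\overline{\mathrm{AGL}}(2,q))=q^3-q^2$. *)

theory Defs
  imports "HOL-Analysis.Analysis" "HOL-Computational_Algebra.Polynomial_Factorial"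
begin

text \<open>Polynomials in K[X,Y,Z], encoded as K[X][Y][Z] (outermost variable Z).\<close>
type_synonym 'a tpoly = "'a poly poly poly"

definition tcoeff :: "'a::zero tpoly \<Rightarrow> nat \<Rightarrow> nat \<Rightarrow> nat \<Rightarrow> 'a" where
  "tcoeff F i j k = coeff (coeff (coeff F k) j) i"

definition homogeneous_of_degree :: "'a::zero tpoly \<Rightarrow> nat \<Rightarrow> bool" where
  "homogeneous_of_degree F d \<longleftrightarrow> F \<noteq> 0 \<and> (\<forall>i j k. tcoeff F i j k \<noteq> 0 \<longrightarrow> i + j + k = d)"

definition tconst :: "'a::zero \<Rightarrow> 'a tpoly" where
  "tconst c = [:[:[:c:]:]:]"

definition varX :: "'a::comm_ring_1 tpoly" where "varX = [:[:[:0, 1:]:]:]"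
definition varY :: "'a::comm_ring_1 tpoly" where "varY = [:[:0, 1:]:]"
definition varZ :: "'a::comm_ring_1 tpoly" where "varZ = [:0, 1:]"

definition tsubst :: "'a::comm_ring_1 tpoly \<Rightarrow> 'a tpoly \<Rightarrow> 'a tpoly \<Rightarrow> 'a tpoly \<Rightarrow> 'a tpoly" where
  "tsubst F A B C =
     (\<Sum>k\<le>degree F. \<Sum>j\<le>degree (coeff F k). \<Sum>i\<le>degree (coeff (coeff F k) j).
        tconst (tcoeff F i j k) * A ^ i * B ^ j * C ^ k)"

definition linform :: "'a::comm_ring_1 ^3^3 \<Rightarrow> 3 \<Rightarrow> 'a tpoly" where
  "linform M i = tconst (M$i$1) * varX + tconst (M$i$2) * varY + tconst (M$i$3) * varZ"

definition mat_act :: "'a::comm_ring_1 ^3^3 \<Rightarrow> 'a tpoly \<Rightarrow> 'a tpoly" where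
  "mat_act M F = tsubst F (linform M 1) (linform M 2) (linform M 3)"

definition curve_invariant :: "('a::field ^3^3) set \<Rightarrow> 'a tpoly \<Rightarrow> bool" where
  "curve_invariant G F \<longleftrightarrow> (\<forall>M\<in>G. \<exists>c. c \<noteq> 0 \<and> mat_act M F = tconst c * F)"

definition degree_spectrum :: "('a::field ^3^3) set \<Rightarrow> nat set" where
  "degree_spectrum G = {n. n \<ge> 2 \<and> (\<exists>F::'a tpoly. irreducible F \<and> homogeneous_of_degree F n \<and> curve_invariant G F)}"

definition dG :: "('a::field ^3^3) set \<Rightarrow> nat" where
  "dG G = (LEAST n. n \<in> degree_spectrum G)"

definition dG' :: "('a::field ^3^3) set \<Rightarrow> nat" where
  "dG' G = (LEAST n. n \<in> degree_spectrum G \<and> n > dG G)"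

definition epsG :: "('a::field ^3^3) set \<Rightarrow> int" where
  "epsG G = int (dG' G) - int (dG G)"

text \<open>The subfield F_q of K (in characteristic p, q a power of p).\<close>
definition Fq :: "nat \<Rightarrow> 'a::field set" where
  "Fq q = {x. x ^ q = x}"

text \<open>Stabilizer in GL(3,q) (preimage of the stabilizer in PGL(3,q)) of the point P.\<close>
definition AGLbar :: "nat \<Rightarrow> 'a::field ^3 \<Rightarrow> ('a ^3^3) set" where
  "AGLbar q P = {M. (\<forall>i j. M$i$j \<in> Fq q) \<and> invertible M \<and> (\<exists>c. M *v P = c *s P)}"

end

theory Submission
  imports "Berlekamp_Zassenhaus.Unique_Factorization_Poly" Defs
begin

text \<open>
  Move the fixed point to \<open>(0 : 0 : 1)\<close>. For an invariant irreducible \<open>F\<close> one has \<open>F(X, Y, 0) \<noteq> 0\<close>,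
  so \<open>F\<close> is fixed exactly by \<open>Z \<mapsto> Z + aX + bY\<close> and by \<open>Z \<mapsto> tZ\<close>; hence \<open>q\<^sup>2(q - 1)\<close> divides the
  degree of \<open>F\<close> in \<open>Z\<close>. If that degree is \<open>q\<^sup>2(q - 1)\<close>, then \<open>F = f\<^sub>1 N\<^bsup>q-1\<^esup> + f\<^sub>0\<close> where \<open>N\<close> is the
  product of all \<open>Z + aX + bY\<close>, and counting the zeros of the semi-invariant binary form \<open>f\<^sub>1\<close> shows
  that it is constant or has degree at least \<open>q\<^sup>2 - q\<close>.

  Both minimal degrees are attained, by \<open>N\<^bsup>q-1\<^esup> - Q\<^sup>q\<close> and \<open>Q(N\<^bsup>q-1\<^esup> - Q\<^sup>q) - D\<^bsup>q(q-1)\<^esup>\<close> with the Dickson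
  invariants \<open>D\<close>, \<open>Q\<close> of \<open>GL(2, q)\<close>. At each of their points \<open>(1 : 0 : z)\<close> the Newton polygon is a
  single edge from \<open>q\<close> to \<open>q - 1\<close>; these are coprime, so only one irreducible factor passes through the
  point. The homologies and elations with axis \<open>Y = 0\<close> therefore fix every factor, and so do those with
  axis \<open>X = 0\<close>. Every factor thus has degree in \<open>Z\<close> divisible by \<open>q\<^sup>2(q - 1)\<close>, the degree of the curve.
\<close>

subsection \<open>Evaluation homomorphisms\<close>

text \<open>Invariance only gives a scalar for each map. Translations keep the leading coefficient
  in Z and scalings keep F(X, Y, 0), which forces the scalar to be 1.

  The obstacle is irreducibility, since the group could permute the factors of an invariant curve.
  Homologies and elations with axis Y = 0 fix that axis pointwise, so they send a factor through (1
  : 0 : z) to a factor through the same point; with only one available there, it goes to itself.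

  The bound q^2 - q for the form f_1 is met by Q, whose zeros are the q^2 - q points of the line
  over F_(q^2) that are not over F_q. This is why Q is the leading coefficient of the second curve.
  The invariant D^(q(q-1)) has the degree of Q(N^(q-1) - Q^q); it breaks up this product, yet
  vanishes so highly on Y = 0 that the Newton polygons there stay the same.\<close>

lemma comm_ring_homI:
  assumes "h 0 = 0" "h 1 = 1" "\<And>x y. h (x + y) = h x + h y" "\<And>x y. h (x * y) = h x * h y"
  shows "comm_ring_hom h"
  using assms by unfold_locales auto

lemma comm_ring_hom_comp:
  assumes "comm_ring_hom f" "comm_ring_hom g"
  shows "comm_ring_hom (\<lambda>x. f (g x))"
proof -
  interpret f: comm_ring_hom f by fact
  interpret g: comm_ring_hom g by fact
  show ?thesis by (rule comm_ring_homI) (simp_all add: f.hom_add g.hom_add f.hom_mult g.hom_mult)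
qed

lemma comm_ring_hom_const: "comm_ring_hom (\<lambda>c. [:c:])"
  by (rule comm_ring_homI) simp_all

lemma comm_ring_hom_id: "comm_ring_hom (\<lambda>c. c)"
  by (rule comm_ring_homI) simp_all

lemma comm_ring_hom_tconst: "comm_ring_hom tconst"
  by (rule comm_ring_homI) (simp_all add: tconst_def)

lemma comm_ring_hom_map_poly:
  assumes "comm_ring_hom h" shows "comm_ring_hom (map_poly h)"
proof -
  interpret h: comm_ring_hom h by fact
  interpret m: map_poly_comm_ring_hom h ..
  show ?thesis ..
qed

lemma comm_ring_hom_poly: "comm_ring_hom (\<lambda>p. poly p a)" ..

lemma comm_ring_hom_pcompose: "comm_ring_hom (\<lambda>p. p \<circ>\<^sub>p a)" ..

lemma comm_ring_hom_eval_poly: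
  assumes "comm_ring_hom h" shows "comm_ring_hom (\<lambda>p. eval_poly h p a)"
  unfolding eval_poly_def
  by (rule comm_ring_hom_comp[OF comm_ring_hom_poly comm_ring_hom_map_poly[OF assms]])

lemma eval_poly_const [simp]: "comm_ring_hom h \<Longrightarrow> eval_poly h [:c:] a = h c"
proof -
  assume "comm_ring_hom h"
  then interpret h: comm_ring_hom h .
  show ?thesis by (cases "c = 0") (simp_all add: eval_poly_def map_poly_pCons)
qed

lemma eval_poly_var [simp]: "comm_ring_hom h \<Longrightarrow> eval_poly h [:0, 1:] a = a"
proof -
  assume "comm_ring_hom h"
  then interpret h: comm_ring_hom h .
  show ?thesis by (simp add: eval_poly_def map_poly_pCons)
qed

lemma eval_poly_pCons_1 [simp]: "comm_ring_hom h \<Longrightarrow> eval_poly h (pCons 0 1) a = a"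
  using eval_poly_var[of h a] by simp

lemma eval_poly_sum_coeff:
  assumes "comm_ring_hom h"
  shows "eval_poly h p a = (\<Sum>i\<le>degree p. h (coeff p i) * a ^ i)"
proof -
  interpret h: comm_ring_hom h by fact
  show ?thesis by (simp add: eval_poly_as_sum mult.commute)
qed

lemma poly_hom_eqI:
  fixes f g :: "'a::comm_ring_1 poly \<Rightarrow> 'b::comm_ring_1"
  assumes "comm_ring_hom f" "comm_ring_hom g"
    and c: "\<And>c. f [:c:] = g [:c:]" and x: "f [:0, 1:] = g [:0, 1:]"
  shows "f = g"
proof
  fix p
  interpret f: comm_ring_hom f by fact
  interpret g: comm_ring_hom g by fact
  show "f p = g p"
  proof (induction p)
    case 0
    show ?case by simp
  next
    case (pCons a p)
    have eq: "pCons a p = [:a:] + [:0, 1:] * p" by simp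
    have "f (pCons a p) = f [:a:] + f [:0, 1:] * f p"
      by (subst eq) (simp only: f.hom_add f.hom_mult)
    moreover have "g (pCons a p) = g [:a:] + g [:0, 1:] * g p"
      by (subst eq) (simp only: g.hom_add g.hom_mult)
    ultimately show ?case by (simp only: c x pCons.IH)
  qed
qed

text \<open>A homomorphism out of K[X][Y][Z] is determined by its values on constants and variables.
  Identities between substitutions are thus checked on generators, without coefficients.\<close>

lemma tpoly_hom_eqI:
  fixes f g :: "'a::comm_ring_1 tpoly \<Rightarrow> 'b::comm_ring_1"
  assumes f: "comm_ring_hom f" and g: "comm_ring_hom g"
    and "\<And>c. f (tconst c) = g (tconst c)"
    and "f varX = g varX" "f varY = g varY" "f varZ = g varZ"
  shows "f = g"
proof -
  have 1: "f [:[:[:c:]:]:] = g [:[:[:c:]:]:]" for c using assms(3) by (simp add: tconst_def)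
  note hc = comm_ring_hom_comp[OF _ comm_ring_hom_const]
  have "(\<lambda>p. f [:[:p:]:]) = (\<lambda>p. g [:[:p:]:])"
    by (rule poly_hom_eqI[OF hc[OF hc[OF f]] hc[OF hc[OF g]]]) (fact 1 assms(4)[unfolded varX_def])+
  then have 2: "f [:[:p:]:] = g [:[:p:]:]" for p unfolding fun_eq_iff by blast
  have "(\<lambda>p. f [:p:]) = (\<lambda>p. g [:p:])"
    by (rule poly_hom_eqI[OF hc[OF f] hc[OF g]]) (fact 2 assms(5)[unfolded varY_def])+
  then have 3: "f [:p:] = g [:p:]" for p unfolding fun_eq_iff by blast
  show ?thesis
    by (rule poly_hom_eqI[OF f g 3 assms(6)[unfolded varZ_def]])
qed

text \<open>Evaluation at (A, B, C) with constants mapped by \<open>h\<close>. Nesting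
  \<open>eval_poly\<close> makes it a homomorphism layer by layer; the target ring is arbitrary,
  since values are taken among scalars, univariate polynomials and polynomials in X, Y, Z.\<close>

definition tev :: "('a::comm_ring_1 \<Rightarrow> 'b::comm_ring_1) \<Rightarrow> 'b \<Rightarrow> 'b \<Rightarrow> 'b \<Rightarrow> 'a tpoly \<Rightarrow> 'b" where
  "tev h A B C F = eval_poly (\<lambda>g. eval_poly (\<lambda>f. eval_poly h f A) g B) F C"

lemma comm_ring_hom_tev:
  assumes "comm_ring_hom h" shows "comm_ring_hom (tev h A B C)"
  unfolding tev_def by (rule comm_ring_hom_eval_poly[OF comm_ring_hom_eval_poly[OF comm_ring_hom_eval_poly[OF assms]]])

lemma tev_simps [simp]:
  assumes "comm_ring_hom h"
  shows "tev h A B C (tconst c) = h c" "tev h A B C varX = A" "tev h A B C varY = B" "tev h A B C varZ = C"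
  using assms unfolding tev_def tconst_def varX_def varY_def varZ_def
  by (simp_all add: comm_ring_hom_eval_poly)

lemma tev_unique:
  assumes "comm_ring_hom f" "comm_ring_hom h" "\<And>c. f (tconst c) = h c"
  shows "f F = tev h (f varX) (f varY) (f varZ) F"
  using tpoly_hom_eqI[OF assms(1) comm_ring_hom_tev[OF assms(2)], of "f varX" "f varY" "f varZ"] assms
  by simp

lemma hom_tev:
  assumes "comm_ring_hom f" "comm_ring_hom h"
  shows "f (tev h A B C F) = tev (\<lambda>c. f (h c)) (f A) (f B) (f C) F"
  using tev_unique[OF comm_ring_hom_comp[OF assms(1) comm_ring_hom_tev[OF assms(2), of A B C]]
      comm_ring_hom_comp[OF assms], of F] assms(2)
  by simp

text \<open>The sums in \<open>tsubst\<close> are the expanded nested evaluations. The coefficient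
  formula returns only where degrees are tracked.\<close>

lemma tsubst_eq_tev: "tsubst F A B C = tev tconst A B C F"
proof -
  note h1 = comm_ring_hom_tconst
  note h2 = comm_ring_hom_eval_poly[OF h1, of A]
  note h3 = comm_ring_hom_eval_poly[OF h2, of B]
  note e = eval_poly_sum_coeff
  show ?thesis
    unfolding tev_def unfolding e[OF h3] unfolding e[OF h2] unfolding e[OF h1]
    by (simp add: tsubst_def tcoeff_def sum_distrib_right)
qed

lemma comm_ring_hom_tsubst: "comm_ring_hom (\<lambda>F. tsubst F A B C)"
  unfolding tsubst_eq_tev by (rule comm_ring_hom_tev[OF comm_ring_hom_tconst])

lemma tsubst_simps [simp]:
  "tsubst (tconst c) A B C = tconst c" "tsubst varX A B C = A" "tsubst varY A B C = B"
  "tsubst varZ A B C = C"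
  by (simp_all add: tsubst_eq_tev comm_ring_hom_tconst)

lemma tev_tsubst:
  assumes "comm_ring_hom h"
  shows "tev h A B C (tsubst F D E G) = tev h (tev h A B C D) (tev h A B C E) (tev h A B C G) F"
  unfolding tsubst_eq_tev
  using hom_tev[OF comm_ring_hom_tev[OF assms] comm_ring_hom_tconst] assms by simp

lemma tsubst_tsubst:
  "tsubst (tsubst F D E G) A B C = tsubst F (tsubst D A B C) (tsubst E A B C) (tsubst G A B C)"
  using tev_tsubst[OF comm_ring_hom_tconst] unfolding tsubst_eq_tev .

lemma tsubst_id [simp]: "tsubst F varX varY varZ = F"
  using tpoly_hom_eqI[OF comm_ring_hom_tsubst comm_ring_hom_id] tsubst_simps by metis

lemma pcompose_vars [simp]:
  "tconst c \<circ>\<^sub>p C = tconst c" "varX \<circ>\<^sub>p C = varX" "varY \<circ>\<^sub>p C = varY" "varZ \<circ>\<^sub>p C = C"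
  by (simp_all add: tconst_def varX_def varY_def varZ_def pcompose_pCons)

lemma tsubst_pcompose: "tsubst F varX varY C = F \<circ>\<^sub>p C"
proof -
  have "(\<lambda>F. tsubst F varX varY C) = (\<lambda>F. F \<circ>\<^sub>p C)"
    by (rule tpoly_hom_eqI[OF comm_ring_hom_tsubst comm_ring_hom_pcompose])
      simp_all
  then show ?thesis by metis
qed

definition bsubst :: "'a::comm_ring_1 poly poly \<Rightarrow> 'a poly poly \<Rightarrow> 'a poly poly \<Rightarrow> 'a poly poly" where
  "bsubst a b f = eval_poly (\<lambda>g. eval_poly (\<lambda>c. [:[:c:]:]) g a) f b"

lemma comm_ring_hom_const2: "comm_ring_hom (\<lambda>c. [:[:c:]:])"
  by (rule comm_ring_hom_comp[OF comm_ring_hom_const comm_ring_hom_const])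

lemma comm_ring_hom_bsubst: "comm_ring_hom (bsubst a b)"
  unfolding bsubst_def by (rule comm_ring_hom_eval_poly[OF comm_ring_hom_eval_poly[OF comm_ring_hom_const2]])

lemma bsubst_simps [simp]:
  "bsubst a b [:[:c:]:] = [:[:c:]:]" "bsubst a b [:[:0, 1:]:] = a" "bsubst a b [:0, 1:] = b"
  unfolding bsubst_def by (simp_all add: comm_ring_hom_const2 comm_ring_hom_eval_poly)

lemma bpoly_hom_eqI:
  fixes f g :: "'a::comm_ring_1 poly poly \<Rightarrow> 'b::comm_ring_1"
  assumes f: "comm_ring_hom f" and g: "comm_ring_hom g"
    and "\<And>c. f [:[:c:]:] = g [:[:c:]:]" "f [:[:0, 1:]:] = g [:[:0, 1:]:]" "f [:0, 1:] = g [:0, 1:]"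
  shows "f = g"
proof -
  note hc = comm_ring_hom_comp[OF _ comm_ring_hom_const]
  have "(\<lambda>p. f [:p:]) = (\<lambda>p. g [:p:])"
    by (rule poly_hom_eqI[OF hc[OF f] hc[OF g]]) (fact assms(3,4))+
  then have 2: "f [:p:] = g [:p:]" for p unfolding fun_eq_iff by blast
  show ?thesis
    by (rule poly_hom_eqI[OF f g 2 assms(5)])
qed

lemma map_poly_bsubst_vars:
  "map_poly (bsubst a b) (tconst c) = tconst c" "map_poly (bsubst a b) varX = [:a:]"
  "map_poly (bsubst a b) varY = [:b:]" "map_poly (bsubst a b) varZ = varZ"
proof -
  interpret b: comm_ring_hom "bsubst a b" by (rule comm_ring_hom_bsubst)
  show "map_poly (bsubst a b) (tconst c) = tconst c" "map_poly (bsubst a b) varX = [:a:]"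
    "map_poly (bsubst a b) varY = [:b:]" "map_poly (bsubst a b) varZ = varZ"
    using bsubst_simps[of a b]
    by (simp_all add: tconst_def varX_def varY_def varZ_def b.map_poly_pCons_hom)
qed

lemma tsubst_map_poly: "tsubst F [:a:] [:b:] varZ = map_poly (bsubst a b) F"
proof -
  interpret b: comm_ring_hom "bsubst a b" by (rule comm_ring_hom_bsubst)
  have "(\<lambda>F. tsubst F [:a:] [:b:] varZ) = map_poly (bsubst a b)"
    by (rule tpoly_hom_eqI[OF comm_ring_hom_tsubst comm_ring_hom_map_poly[OF comm_ring_hom_bsubst]])
      (simp_all add: map_poly_bsubst_vars)
  then show ?thesis by metis
qed

lemma coeff_tsubst_bsubst: "coeff (tsubst F [:a:] [:b:] varZ) k = bsubst a b (coeff F k)"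
proof -
  interpret b: comm_ring_hom "bsubst a b" by (rule comm_ring_hom_bsubst)
  show ?thesis by (simp add: tsubst_map_poly coeff_map_poly)
qed

section \<open>Matrices acting on polynomials by linear substitution\<close>

lemma comm_ring_hom_mat_act: "comm_ring_hom (mat_act M)"
  unfolding mat_act_def by (rule comm_ring_hom_tsubst)

lemma mat_act_linform: "mat_act N (linform M i) = linform (M ** N) i"
proof -
  interpret m: comm_ring_hom "mat_act N" by (rule comm_ring_hom_mat_act)
  interpret t: comm_ring_hom "tconst :: 'a \<Rightarrow> _" by (rule comm_ring_hom_tconst)
  have [simp]: "mat_act N (tconst c) = tconst c" "mat_act N varX = linform N 1"
    "mat_act N varY = linform N 2" "mat_act N varZ = linform N 3" for c
    by (simp_all add: mat_act_def)
  show ?thesis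
    by (simp add: linform_def[of M] m.hom_add m.hom_mult)
      (simp add: linform_def matrix_matrix_mult_def sum_3 t.hom_add t.hom_mult algebra_simps)
qed

text \<open>Substitution is a right action, so the matrix applied first stands on the left; the
  conjugations below depend on this order.\<close>

lemma mat_act_mat_act: "mat_act N (mat_act M F) = mat_act (M ** N) F"
  unfolding mat_act_def[of M] mat_act_def[of "M ** N"] 
  using mat_act_linform[of N M] by (simp add: mat_act_def[of N] tsubst_tsubst)

lemma mat_act_one [simp]: "mat_act (mat 1) F = F"
proof -
  interpret t: comm_ring_hom "tconst :: 'a \<Rightarrow> _" by (rule comm_ring_hom_tconst)
  show ?thesis by (simp add: mat_act_def linform_def mat_def)
qed

subsection \<open>Finite fields inside an algebraically closed field\<close>

hide_const (open) Coset.order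

lemma degree_diff_eq_left:
  fixes f g :: "'a::ab_group_add poly"
  assumes "degree g < degree f" shows "degree (f - g) = degree f"
  using degree_add_eq_left[of "- g" f] assms by simp

lemma card_roots_separable:
  fixes f :: "'a::field poly"
  assumes AC: "\<And>f::'a poly. degree f > 0 \<Longrightarrow> \<exists>x. poly f x = 0"
    and "f \<noteq> 0" "\<And>a. order a f \<le> 1"
  shows "card {a. poly f a = 0} = degree f"
  using assms(2,3)
proof (induction "degree f" arbitrary: f)
  case 0
  then have "{a. poly f a = 0} = {}"
    by (auto elim!: degree_eq_zeroE)
  then show ?case using 0 by simp
next
  case (Suc d)
  then obtain r where r: "poly f r = 0" using AC[of f] by auto
  then obtain g where g: "f = [:-r, 1:] * g" by (metis poly_eq_0_iff_dvd dvdE)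
  have g0: "g \<noteq> 0" using g Suc.prems by auto
  have ord: "order a f = order a [:-r, 1:] + order a g" for a
    unfolding g using g Suc.prems(1) by (intro order_mult) simp
  have "order r [:-r, 1:] = 1" using order_power_n_n[of r 1] by simp
  then have gr: "poly g r \<noteq> 0" using ord[of r] Suc.prems(2)[of r] g0 by (simp add: order_root)
  have deg: "degree f = Suc (degree g)" unfolding g using g0 by (subst degree_mult_eq) auto
  have "card {a. poly g a = 0} = degree g"
    by (rule Suc.hyps(1)) (use deg Suc.hyps(2) g0 ord Suc.prems(2) in \<open>auto intro: order_trans[OF le_add2]\<close>)
  moreover have "{a. poly f a = 0} = insert r {a. poly g a = 0}" using g by auto
  moreover have "finite {a. poly g a = 0}" using g0 by (rule poly_roots_finite)
  ultimately show ?case using gr deg by simp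
qed

locale alg_closed_char_p =
  fixes p expo q :: nat and K :: "'k::field itself"
  assumes p_prime: "prime p" and expo_pos: "expo \<ge> 1" and q_eq: "q = p ^ expo"
    and of_nat_p: "of_nat p = (0::'k)"
    and alg_closed: "\<And>f::'k poly. degree f > 0 \<Longrightarrow> \<exists>x. poly f x = 0"
begin

abbreviation F :: "'k set" where "F \<equiv> Fq q"

lemma q_ge_2: "q \<ge> 2"
  using p_prime expo_pos unfolding q_eq
  by (metis prime_ge_2_nat self_le_power order_trans less_eq_Suc_le One_nat_def prime_gt_0_nat)

lemma q_gt_0 [simp]: "q > 0" and q_gt_1: "q > 1" using q_ge_2 by auto

lemma CHAR_K: "CHAR('k) = p"
  by (metis CHAR_not_1 of_nat_eq_0_iff_char_dvd of_nat_p One_nat_def p_prime prime_nat_iff)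

text \<open>Stated for every ring of characteristic p, because it is applied in K and in the
  polynomial rings over K.\<close>

lemma frob_add:
  fixes x y :: "'r::comm_ring_1"
  assumes "CHAR('r) = p" shows "(x + y) ^ q = x ^ q + y ^ q"
  using freshmans_dream'[of q expo x y] assms p_prime q_eq by simp

lemma frob_diff:
  fixes x y :: "'r::comm_ring_1"
  assumes "CHAR('r) = p" shows "(x - y) ^ q = x ^ q - y ^ q"
  using frob_add[OF assms, of "x - y" y] by simp

lemma frob_uminus:
  fixes x :: "'r::comm_ring_1"
  assumes "CHAR('r) = p" shows "(- x) ^ q = - (x ^ q)"
  using frob_diff[OF assms, of 0 x] q_gt_0 by (simp add: power_0_left)

lemma F_closed [simp]:
  "0 \<in> F" "1 \<in> F" "x \<in> F \<Longrightarrow> y \<in> F \<Longrightarrow> x + y \<in> F" "x \<in> F \<Longrightarrow> - x \<in> F"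
  "x \<in> F \<Longrightarrow> y \<in> F \<Longrightarrow> x - y \<in> F" "x \<in> F \<Longrightarrow> y \<in> F \<Longrightarrow> x * y \<in> F"
  "x \<in> F \<Longrightarrow> inverse x \<in> F" "x \<in> F \<Longrightarrow> y \<in> F \<Longrightarrow> x / y \<in> F"
  by (simp_all add: Fq_def power_0_left frob_add frob_diff frob_uminus CHAR_K power_mult_distrib
      power_inverse divide_inverse)

lemma F_power: "x \<in> F \<Longrightarrow> x ^ q = x" by (simp add: Fq_def)

text \<open>The polynomial T^q - T has derivative -1, hence only simple roots.\<close>

lemma finite_F [simp]: "finite F" and card_F: "card F = q"
proof -
  define f :: "'k poly" where "f = monom 1 q - [:0, 1:]"
  have roots: "{a. poly f a = 0} = F" by (auto simp: f_def Fq_def poly_monom)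
  have deg: "degree f = q"
    unfolding f_def using q_gt_1 by (subst degree_diff_eq_left) (auto simp: degree_monom_eq)
  have f0: "f \<noteq> 0" using deg q_gt_0 by force
  have ord: "order a f \<le> 1" for a
  proof (rule ccontr)
    assume "\<not> order a f \<le> 1"
    then have "[:-a, 1:] ^ 2 dvd f" by (subst order_divides) (simp add: f0)
    then obtain g where "f = [:-a, 1:] ^ 2 * g" by auto
    then have "f = [:-a, 1:] * ([:-a, 1:] * g)" by (simp only: power2_eq_square mult.assoc)
    then have "poly (pderiv f) a = 0" by (simp only: pderiv_mult poly_add poly_mult) simp
    moreover have "pderiv f = - 1"
    proof -
      have "of_nat q = (0::'k)" using of_nat_p expo_pos by (simp add: q_eq)
      then show ?thesis by (simp add: f_def pderiv_diff pderiv_monom pderiv_pCons)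
    qed
    ultimately show False by simp
  qed
  show "card F = q" using card_roots_separable[OF alg_closed f0 ord] roots deg by simp
  show "finite F" using poly_roots_finite[OF f0] roots by simp
qed

lemma F_power_minus_1:
  assumes "t \<in> F" "t \<noteq> 0" shows "t ^ (q - 1) = 1"
proof -
  have "t ^ (q - 1) * t = 1 * t"
    using F_power[OF assms(1)] q_gt_0 by (simp flip: power_Suc2)
  then show ?thesis using assms(2) by simp
qed

text \<open>Otherwise m has a positive remainder r modulo q - 1, and T^r - 1 has q - 1 > r roots.
  This bypasses the cyclicity of the multiplicative group.\<close>

lemma q_minus_1_dvd_exponent:
  assumes "\<And>t. t \<in> F \<Longrightarrow> t \<noteq> 0 \<Longrightarrow> t ^ m = 1"
  shows "(q - 1) dvd m"
proof (rule ccontr)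
  assume ndvd: "\<not> (q - 1) dvd m"
  define r where "r = m mod (q - 1)"
  have r: "0 < r" "r < q - 1" using ndvd q_gt_1 by (auto simp: r_def dvd_eq_mod_eq_0)
  define f :: "'k poly" where "f = monom 1 r - 1"
  have deg: "degree f = r"
    unfolding f_def using r by (subst degree_diff_eq_left) (auto simp: degree_monom_eq)
  have f0: "f \<noteq> 0" using deg r by force
  have "F - {0} \<subseteq> {a. poly f a = 0}"
  proof
    fix t assume t: "t \<in> F - {0}"
    have "t ^ m = t ^ ((q - 1) * (m div (q - 1)) + r)" by (simp add: r_def)
    also have "\<dots> = t ^ r" unfolding power_add power_mult using F_power_minus_1 t by simp
    finally show "t \<in> {a. poly f a = 0}" using assms[of t] t by (simp add: f_def poly_monom)
  qed
  then have "card (F - {0}) \<le> card {a. poly f a = 0}"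
    using poly_roots_finite[OF f0] by (rule card_mono[rotated])
  also have "\<dots> \<le> r" using card_poly_roots_bound[OF f0] deg by simp
  finally show False using r card_F by (simp add: card_Diff_singleton)
qed

end

subsection \<open>Translation-invariant polynomials\<close>

lemma prod_linear_dvd:
  fixes f :: "'r::idom poly"
  assumes "finite V" "\<And>v. v \<in> V \<Longrightarrow> poly f v = 0"
  shows "(\<Prod>v\<in>V. [:-v, 1:]) dvd f"
  using assms
proof (induction V arbitrary: f)
  case (insert a V)
  then obtain g where g: "f = [:-a, 1:] * g" by (metis insertI1 poly_eq_0_iff_dvd dvdE)
  have "poly g v = 0" if "v \<in> V" for v
    using insert.prems[of v] insert.hyps(2) that g by auto
  then have "(\<Prod>v\<in>V. [:-v, 1:]) dvd g" by (rule insert.IH)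
  then show ?case using g insert.hyps by (simp del: mult_pCons_left)
qed simp

text \<open>As f is constant on V, the product P of all T - v divides f - f(0). The quotient
  inherits the invariance, and induction on the degree applies. Coefficients lie in an integral
  domain because V will consist of the linear forms aX + bY.\<close>

lemma card_dvd_degree_of_translation_invariant:
  fixes f :: "'r::idom poly"
  assumes V: "finite V" "0 \<in> V" "\<And>u v. u \<in> V \<Longrightarrow> v \<in> V \<Longrightarrow> u + v \<in> V"
    and inv: "\<And>v. v \<in> V \<Longrightarrow> f \<circ>\<^sub>p [:v, 1:] = f"
  shows "card V dvd degree f"
  using inv
proof (induction "degree f" arbitrary: f rule: less_induct)
  case less
  show ?case
  proof (cases "degree f = 0")
    case False
    define P where "P = (\<Prod>v\<in>V. [:-v, 1:])"
    have P0: "P \<noteq> 0" using V(1) by (simp add: P_def)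
    have degP: "degree P = card V" unfolding P_def by (subst degree_prod_eq_sum_degree) auto
    have Pinv: "P \<circ>\<^sub>p [:u, 1:] = P" if "u \<in> V" for u
    proof -
      have inj: "inj_on (\<lambda>v. v + u) V" by (simp add: inj_on_def)
      \<comment> \<open>An injective self-map of a finite set is a permutation, so translation by u
        permutes the roots of P.\<close>
      have im: "(\<lambda>v. v + u) ` V = V"
        using V that by (intro card_subset_eq) (auto simp: card_image[OF inj])
      have "P = (\<Prod>v\<in>(\<lambda>v. v + u) ` V. [:-v, 1:])" unfolding im P_def ..
      also have "\<dots> = (\<Prod>v\<in>V. [:-(v + u), 1:])" by (subst prod.reindex[OF inj]) simp
      finally have eq: "P = (\<Prod>v\<in>V. [:-(v + u), 1:])" .
      show ?thesis by (subst eq) (simp add: P_def pcompose_prod pcompose_pCons)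
    qed
    define c where "c = [:poly f 0:]"
    have "poly (f - c) v = 0" if "v \<in> V" for v
      using arg_cong[OF less.prems[OF that], of "\<lambda>f. poly f 0"] by (simp add: c_def poly_pcompose)
    then have "P dvd f - c" unfolding P_def by (intro prod_linear_dvd V)
    then obtain g where g: "f - c = P * g" ..
    have degc: "degree c < degree f" using False by (simp add: c_def)
    have deg: "degree (P * g) = degree f" unfolding g[symmetric] using degc by (rule degree_diff_eq_left)
    then have g0: "g \<noteq> 0" using False by auto
    have deg2: "degree f = card V + degree g" using deg degree_mult_eq[OF P0 g0] degP by simp
    have "g \<circ>\<^sub>p [:v, 1:] = g" if "v \<in> V" for v
    proof -
      have "P * g = (P * g) \<circ>\<^sub>p [:v, 1:]"
        unfolding g[symmetric] using less.prems[OF that] by (simp add: pcompose_diff c_def)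
      also have "\<dots> = P * (g \<circ>\<^sub>p [:v, 1:])" using Pinv[OF that] by (simp add: pcompose_mult)
      finally show ?thesis using P0 by simp
    qed
    moreover have "degree g < degree f" using deg2 V by (auto simp: card_gt_0_iff)
    ultimately have "card V dvd degree g" by (rule less.hyps[rotated])
    then show ?thesis using deg2 by simp
  qed simp
qed

subsection \<open>Dickson invariants\<close>

text \<open>Up to a scalar, the product of the q + 1 linear forms belonging to the points of the
  projective line over F_q. The invariants are defined over any commutative ring so that they
  commute with evaluations.\<close>

definition dickson_D :: "nat \<Rightarrow> 'r::comm_ring_1 \<Rightarrow> 'r \<Rightarrow> 'r" where
  "dickson_D q x y = x * y ^ q - x ^ q * y"

text \<open>A geometric sum: the division-free form of (x y^(q^2) - x^(q^2) y) / (x y^q - x^q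
  y).\<close>

definition dickson_Q :: "nat \<Rightarrow> 'r::comm_ring_1 \<Rightarrow> 'r \<Rightarrow> 'r" where
  "dickson_Q q x y = (\<Sum>i\<le>q. (x ^ (q - 1)) ^ i * (y ^ (q - 1)) ^ (q - i))"

definition dickson_phi :: "nat \<Rightarrow> 'r::comm_ring_1 \<Rightarrow> 'r \<Rightarrow> 'r" where
  "dickson_phi q x t = t ^ q - x ^ (q - 1) * t"

text \<open>The closed form of \<open>\<Prod>(z + ax + by)\<close> over all \<open>a, b \<in> F\<^sub>q\<close>: for fixed \<open>x\<close>, \<open>dickson_phi q x\<close> is additive
  with kernel \<open>F\<^sub>q x\<close>.\<close>

definition dickson_N :: "nat \<Rightarrow> 'r::comm_ring_1 \<Rightarrow> 'r \<Rightarrow> 'r \<Rightarrow> 'r" where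
  "dickson_N q x y z = dickson_phi q x z ^ q - dickson_phi q x z * dickson_phi q x y ^ (q - 1)"

definition pencil :: "nat \<Rightarrow> 'r::comm_ring_1 \<Rightarrow> 'r \<Rightarrow> 'r \<Rightarrow> 'r" where
  "pencil q x y z = dickson_N q x y z ^ (q - 1) - dickson_Q q x y ^ q"

text \<open>One definition for both curves, so that their local analysis is done once;
  \<open>j\<close> selects the one of degree q^3 - q.\<close>

definition curve :: "nat \<Rightarrow> bool \<Rightarrow> 'r::comm_ring_1 \<Rightarrow> 'r \<Rightarrow> 'r \<Rightarrow> 'r" where
  "curve q j x y z =
     (if j then dickson_Q q x y * pencil q x y z - dickson_D q x y ^ (q * (q - 1)) else pencil q x y z)"

lemma hom_dickson:
  assumes "comm_ring_hom h"
  shows "h (dickson_D q x y) = dickson_D q (h x) (h y)"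
    "h (dickson_Q q x y) = dickson_Q q (h x) (h y)"
    "h (dickson_phi q x y) = dickson_phi q (h x) (h y)"
    "h (dickson_N q x y z) = dickson_N q (h x) (h y) (h z)"
    "h (pencil q x y z) = pencil q (h x) (h y) (h z)"
    "h (curve q j x y z) = curve q j (h x) (h y) (h z)"
proof -
  interpret h: comm_ring_hom h by fact
  show 1: "h (dickson_D q x y) = dickson_D q (h x) (h y)" for x y
    by (simp add: dickson_D_def h.hom_minus h.hom_mult h.hom_power)
  show 2: "h (dickson_Q q x y) = dickson_Q q (h x) (h y)" for x y
    by (simp add: dickson_Q_def h.hom_sum h.hom_mult h.hom_power)
  show 3: "h (dickson_phi q x y) = dickson_phi q (h x) (h y)" for x y
    by (simp add: dickson_phi_def h.hom_minus h.hom_mult h.hom_power)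
  show 4: "h (dickson_N q x y z) = dickson_N q (h x) (h y) (h z)"
    by (simp add: dickson_N_def 3 h.hom_minus h.hom_mult h.hom_power)
  show 5: "h (pencil q x y z) = pencil q (h x) (h y) (h z)"
    by (simp add: pencil_def 2 4 h.hom_minus h.hom_mult h.hom_power)
  show "h (curve q j x y z) = curve q j (h x) (h y) (h z)"
    by (simp add: curve_def 1 2 5 h.hom_minus h.hom_mult h.hom_power)
qed

text \<open>With A = x^(q-1) and B = y^(q-1), D is xy(B - A) and Q telescopes against B - A. The
  right side is F_q-linear in x and in y, which the sum defining Q does not show.\<close>

lemma dickson_Q_times_D:
  fixes x y :: "'r::comm_ring_1"
  assumes "q > 0"
  shows "dickson_Q q x y * dickson_D q x y = x * (y ^ q) ^ q - (x ^ q) ^ q * y"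
proof -
  define A where "A = x ^ (q - 1)"
  define B where "B = y ^ (q - 1)"
  have xA: "x ^ q = x * A" and yB: "y ^ q = y * B"
    using assms by (simp_all add: A_def B_def flip: power_Suc)
  have "dickson_D q x y = x * y * (B - A)"
    by (simp add: dickson_D_def xA yB algebra_simps)
  moreover have "(B - A) * dickson_Q q x y = B ^ Suc q - A ^ Suc q"
  proof -
    have "A ^ Suc q - B ^ Suc q = (A - B) * dickson_Q q x y"
      unfolding diff_power_eq_sum dickson_Q_def lessThan_Suc_atMost A_def B_def ..
    then show ?thesis by (simp add: algebra_simps)
  qed
  ultimately have "dickson_Q q x y * dickson_D q x y = x * y * (B ^ Suc q - A ^ Suc q)"
    by (metis mult.assoc mult.commute)
  also have "\<dots> = x * ((y * B) * B ^ q) - (x * A) * A ^ q * y"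
    by (simp add: algebra_simps)
  also have "(y * B) * B ^ q = (y ^ q) ^ q" by (metis power_mult_distrib yB)
  also have "(x * A) * A ^ q = (x ^ q) ^ q" by (metis power_mult_distrib xA)
  finally show ?thesis .
qed

context alg_closed_char_p
begin

text \<open>The right side is the Moore determinant of x, y, z, expanded along z. It treats the
  three arguments alike, whereas the formula for N singles out x.\<close>

lemma dickson_N_times_D:
  fixes x y z :: "'r::idom"
  assumes "CHAR('r) = p" "x \<noteq> 0"
  shows "dickson_N q x y z * dickson_D q x y =
    (z ^ q) ^ q * (x * y ^ q - x ^ q * y) - z ^ q * (x * (y ^ q) ^ q - (x ^ q) ^ q * y)
      + z * (x ^ q * (y ^ q) ^ q - (x ^ q) ^ q * y ^ q)"
proof -
  \<comment> \<open>Sylvester's identity for the Moore determinant of \<open>x, y, z\<close>, expanded on the right\<close>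
  have sylvester: "(x1 * z2 - x2 * z1) * (x0 * y1 - x1 * y0) - (x0 * z1 - x1 * z0) * (x1 * y2 - x2 * y1)
      = x1 * (z2 * (x0 * y1 - x1 * y0) - z1 * (x0 * y2 - x2 * y0) + z0 * (x1 * y2 - x2 * y1))"
    for x0 x1 x2 y0 y1 y2 z0 z1 z2 :: 'r
    by (simp add: algebra_simps)
  define Dz where "Dz = dickson_D q x z"
  define Dy where "Dy = dickson_D q x y"
  \<comment> \<open>Multiplication by x turns \<open>dickson_phi q x t\<close> into a 2 x 2 Moore
    determinant; the factor x^q brought in by this is cancelled at the end.\<close>
  have xphi: "x * dickson_phi q x t = dickson_D q x t" for t
    using q_gt_0 by (simp add: dickson_phi_def dickson_D_def right_diff_distrib flip: power_Suc mult.assoc)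
  have pow: "x ^ q * dickson_phi q x t ^ q = dickson_D q x t ^ q" for t
    by (simp add: xphi flip: power_mult_distrib)
  have "x ^ q * (dickson_N q x y z * Dy)
      = x ^ q * dickson_phi q x z ^ q * Dy - (x * dickson_phi q x z) * (x ^ q * (dickson_phi q x y ^ (q - 1) * dickson_phi q x y))"
    unfolding dickson_N_def Dy_def xphi[symmetric, of y] by (simp add: algebra_simps)
  also have "dickson_phi q x y ^ (q - 1) * dickson_phi q x y = dickson_phi q x y ^ q"
    using q_gt_0 by (simp flip: power_Suc2)
  finally have "x ^ q * (dickson_N q x y z * Dy) = Dz ^ q * Dy - Dz * Dy ^ q"
    by (simp only: pow xphi Dz_def Dy_def)
  also have "Dz ^ q = x ^ q * (z ^ q) ^ q - (x ^ q) ^ q * z ^ q"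
    by (simp add: Dz_def dickson_D_def frob_diff[OF assms(1)] power_mult_distrib)
  also have "Dy ^ q = x ^ q * (y ^ q) ^ q - (x ^ q) ^ q * y ^ q"
    by (simp add: Dy_def dickson_D_def frob_diff[OF assms(1)] power_mult_distrib)
  also have "(x ^ q * (z ^ q) ^ q - (x ^ q) ^ q * z ^ q) * Dy - Dz * (x ^ q * (y ^ q) ^ q - (x ^ q) ^ q * y ^ q)
     = x ^ q * ((z ^ q) ^ q * (x * y ^ q - x ^ q * y) - z ^ q * (x * (y ^ q) ^ q - (x ^ q) ^ q * y)
      + z * (x ^ q * (y ^ q) ^ q - (x ^ q) ^ q * y ^ q))"
    unfolding Dz_def Dy_def dickson_D_def by (rule sylvester)
  finally show ?thesis using assms(2) by (simp add: Dy_def)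
qed

text \<open>D, QD and ND are determinants of Moore type, linear over the elements fixed by
  Frobenius, so a linear change multiplies them by its determinant. Cancelling D, which must not
  vanish, gives Q and N.\<close>

lemma dickson_linear_change:
  fixes x y z a b c d e f g :: "'r::idom"
  assumes ch: "CHAR('r) = p"
    and fix_q: "a ^ q = a" "b ^ q = b" "c ^ q = c" "d ^ q = d" "e ^ q = e" "f ^ q = f" "g ^ q = g"
    and nz: "a * d - b * c \<noteq> 0" "g \<noteq> 0" "dickson_D q x y \<noteq> 0"
  shows "dickson_D q (a * x + b * y) (c * x + d * y) = (a * d - b * c) * dickson_D q x y"
    and "dickson_Q q (a * x + b * y) (c * x + d * y) = dickson_Q q x y"
    and "dickson_N q (a * x + b * y) (c * x + d * y) (e * x + f * y + g * z) = g * dickson_N q x y z"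
proof -
  define u v w where "u = a * x + b * y" and "v = c * x + d * y" and "w = e * x + f * y + g * z"
  note fr = frob_add[OF ch] power_mult_distrib fix_q
  have u1: "u ^ q = a * x ^ q + b * y ^ q" and v1: "v ^ q = c * x ^ q + d * y ^ q"
    and w1: "w ^ q = e * x ^ q + f * y ^ q + g * z ^ q"
    by (simp_all add: u_def v_def w_def fr)
  have u2: "(u ^ q) ^ q = a * (x ^ q) ^ q + b * (y ^ q) ^ q"
    and v2: "(v ^ q) ^ q = c * (x ^ q) ^ q + d * (y ^ q) ^ q"
    and w2: "(w ^ q) ^ q = e * (x ^ q) ^ q + f * (y ^ q) ^ q + g * (z ^ q) ^ q"
    by (simp_all add: u1 v1 w1 fr)
  have D: "dickson_D q u v = (a * d - b * c) * dickson_D q x y"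
    unfolding dickson_D_def u1 v1 unfolding u_def v_def by (simp add: algebra_simps)
  have D0: "dickson_D q u v \<noteq> 0" using D nz by simp
  have "dickson_Q q u v * dickson_D q u v = (a * d - b * c) * (x * (y ^ q) ^ q - (x ^ q) ^ q * y)"
    unfolding dickson_Q_times_D[OF q_gt_0] u2 v2 unfolding u_def v_def by (simp add: algebra_simps)
  also have "\<dots> = dickson_Q q x y * dickson_D q u v"
    unfolding dickson_Q_times_D[OF q_gt_0, symmetric] D by (simp add: mult_ac)
  finally have Q: "dickson_Q q u v = dickson_Q q x y" using D0 by simp
  have u0: "u \<noteq> 0" using D0 q_gt_0 by (auto simp: dickson_D_def)
  have x0: "x \<noteq> 0" using nz q_gt_0 by (auto simp: dickson_D_def)
  have "dickson_N q u v w * dickson_D q u v = (a * d - b * c) * g * (dickson_N q x y z * dickson_D q x y)"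
    unfolding dickson_N_times_D[OF ch u0] dickson_N_times_D[OF ch x0]
    unfolding u2 v2 w2 unfolding u1 v1 w1
    unfolding u_def v_def w_def by (simp add: algebra_simps)
  also have "\<dots> = g * dickson_N q x y z * dickson_D q u v"
    unfolding D by (simp add: mult_ac)
  finally have N: "dickson_N q u v w = g * dickson_N q x y z" using D0 by simp
  show "dickson_D q (a * x + b * y) (c * x + d * y) = (a * d - b * c) * dickson_D q x y"
    "dickson_Q q (a * x + b * y) (c * x + d * y) = dickson_Q q x y"
    "dickson_N q (a * x + b * y) (c * x + d * y) (e * x + f * y + g * z) = g * dickson_N q x y z"
    using D Q N by (simp_all add: u_def v_def w_def)
qed

text \<open>The determinant and \<open>g\<close> have (q-1)-st power 1, which is why N and D enter
  the curves with exponents divisible by q - 1.\<close>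

lemma curve_linear_change:
  fixes x y z a b c d e f g :: "'r::idom"
  assumes ch: "CHAR('r) = p"
    and fix_q: "a ^ q = a" "b ^ q = b" "c ^ q = c" "d ^ q = d" "e ^ q = e" "f ^ q = f" "g ^ q = g"
    and nz: "a * d - b * c \<noteq> 0" "g \<noteq> 0" "dickson_D q x y \<noteq> 0"
  shows "curve q j (a * x + b * y) (c * x + d * y) (e * x + f * y + g * z) = curve q j x y z"
proof -
  have fix_pow: "t ^ (q - 1) = 1" if "t ^ q = t" "t \<noteq> 0" for t :: 'r
  proof -
    have "t ^ (q - 1) * t = 1 * t" using that q_gt_0 by (simp flip: power_Suc2)
    then show ?thesis using that by simp
  qed
  have "(a * d - b * c) ^ q = a * d - b * c"
    by (simp add: frob_diff[OF ch] power_mult_distrib fix_q)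
  then have "(a * d - b * c) ^ (q * (q - 1)) = 1"
    using fix_pow nz(1) by (simp add: power_mult)
  moreover have "g ^ (q - 1) = 1" using fix_pow fix_q nz by simp
  ultimately show ?thesis
    using dickson_linear_change[OF assms]
    by (simp add: curve_def pencil_def power_mult_distrib)
qed

end

subsection \<open>The stabilizer of the third coordinate point\<close>

lemma tconst_mult: "tconst c * G = smult [:[:c:]:] G"
  by (simp add: tconst_def)

lemma tconst_eq_0_iff [simp]: "tconst c = 0 \<longleftrightarrow> c = 0"
  by (simp add: tconst_def)

lemma varXY_eq: "varX = [:[:[:0, 1:]:]:]" "varY = [:[:0, 1:]:]"
  by (simp_all add: varX_def varY_def)

text \<open>Fixing (0 : 0 : 1) means that the third column is a multiple of the third unit
  vector.\<close>

definition lower_block :: "'a \<Rightarrow> 'a \<Rightarrow> 'a \<Rightarrow> 'a \<Rightarrow> 'a \<Rightarrow> 'a \<Rightarrow> 'a \<Rightarrow> 'a::field^3^3" where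
  "lower_block a b c d e f g = vector [vector [a, b, 0], vector [c, d, 0], vector [e, f, g]]"

definition xysubst :: "'a::field tpoly \<Rightarrow> 'a \<Rightarrow> 'a \<Rightarrow> 'a \<Rightarrow> 'a \<Rightarrow> 'a \<Rightarrow> 'a \<Rightarrow> 'a \<Rightarrow> 'a tpoly" where
  "xysubst G a b c d e f g = tsubst G (tconst a * varX + tconst b * varY)
     (tconst c * varX + tconst d * varY) (tconst e * varX + tconst f * varY + tconst g * varZ)"

lemma mat_act_lower_block: "mat_act (lower_block a b c d e f g) G = xysubst G a b c d e f g"
  by (simp add: mat_act_def xysubst_def lower_block_def linform_def tconst_def)

lemma det_lower_block: "det (lower_block a b c d e f g) = (a * d - b * c) * g"
  by (simp add: det_3 lower_block_def algebra_simps)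

lemma lower_block_in_AGLbar:
  assumes "{a, b, c, d, e, f, g} \<subseteq> Fq q" "0 \<in> (Fq q :: 'a::field set)" "a * d - b * c \<noteq> 0" "g \<noteq> 0"
  shows "lower_block a b c d e f g \<in> AGLbar q (axis 3 1 :: 'a^3)"
proof -
  have "invertible (lower_block a b c d e f g)"
    using assms by (simp add: invertible_det_nz det_lower_block)
  moreover have "\<forall>i j. lower_block a b c d e f g $ i $ j \<in> Fq q"
    using assms by (simp add: forall_3 lower_block_def)
  moreover have "lower_block a b c d e f g *v axis 3 1 = g *s axis 3 1"
    by (simp add: vec_eq_iff forall_3 lower_block_def matrix_vector_mult_def sum_3 axis_def)
  ultimately show ?thesis unfolding AGLbar_def by blast
qed

lemma AGLbar_axis_lower_block:
  assumes "M \<in> AGLbar q (axis 3 1 :: 'a::field^3)"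
  obtains a b c d e f g where "M = lower_block a b c d e f g" "{a, b, c, d, e, f, g} \<subseteq> Fq q"
    "a * d - b * c \<noteq> 0" "g \<noteq> 0"
proof -
  from assms obtain k where M: "\<forall>i j. M$i$j \<in> Fq q" "invertible M" "M *v axis 3 1 = k *s axis 3 1"
    by (auto simp: AGLbar_def)
  have "M$1$3 = 0" "M$2$3 = 0"
    using M(3) by (simp_all add: vec_eq_iff forall_3 matrix_vector_mult_def sum_3 axis_def)
  then have eq: "M = lower_block (M$1$1) (M$1$2) (M$2$1) (M$2$2) (M$3$1) (M$3$2) (M$3$3)"
    by (simp add: vec_eq_iff forall_3 lower_block_def)
  have "det M \<noteq> 0" using M(2) by (simp add: invertible_det_nz)
  then have "(M$1$1 * M$2$2 - M$1$2 * M$2$1) * M$3$3 \<noteq> 0"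
    using eq det_lower_block by metis
  then show thesis using that[OF eq] M(1) by auto
qed

context alg_closed_char_p
begin

abbreviation AGL0 :: "('k^3^3) set" where "AGL0 \<equiv> AGLbar q (axis 3 1)"

lemma curve_invariant_xysubst:
  assumes "curve_invariant AGL0 G" "{a, b, c, d, e, f, g} \<subseteq> F" "a * d - b * c \<noteq> 0" "g \<noteq> 0"
  obtains k where "k \<noteq> 0" "xysubst G a b c d e f g = tconst k * G"
  using assms lower_block_in_AGLbar[OF assms(2) _ assms(3,4)]
  unfolding curve_invariant_def by (metis F_closed(1) mat_act_lower_block)

lemma CHAR_tpoly: "CHAR('k tpoly) = p" and CHAR_bpoly: "CHAR('k poly poly) = p"
  and CHAR_poly: "CHAR('k poly) = p"
  by (simp_all add: CHAR_K)

lemma tconst_F: "a \<in> F \<Longrightarrow> tconst a ^ q = tconst a"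
proof -
  assume "a \<in> F"
  interpret t: comm_ring_hom "tconst :: 'k \<Rightarrow> _" by (rule comm_ring_hom_tconst)
  show ?thesis using \<open>a \<in> F\<close> by (simp flip: t.hom_power add: F_power)
qed

lemma dickson_D_bivariate_nonzero: "dickson_D q [:[:0, 1:]:] [:0, 1:] \<noteq> (0 :: 'k poly poly)"
proof
  assume "dickson_D q [:[:0, 1:]:] [:0, 1:] = (0 :: 'k poly poly)"
  then have "poly (dickson_D q [:[:0, 1:]:] [:0, 1:]) 1 = (0 :: 'k poly)" by simp
  then have "dickson_D q [:0, 1:] 1 = (0 :: 'k poly)"
    using hom_dickson(1)[OF comm_ring_hom_poly, of q "[:[:0, 1::'k:]:]" "[:0, 1:]" 1] by simp
  then have "[:0, 1:] = monom (1::'k) q"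
    by (simp add: dickson_D_def monom_altdef)
  then have "degree [:0, 1::'k:] = q" by (metis degree_monom_eq one_neq_zero)
  then show False using q_gt_1 by simp
qed

lemma dickson_D_nonzero: "dickson_D q varX varY \<noteq> (0 :: 'k tpoly)"
  using dickson_D_bivariate_nonzero hom_dickson(1)[OF comm_ring_hom_const, of q "[:[:0, 1:]:]" "[:0, 1::'k poly:]"]
  by (metis pCons_eq_0_iff varXY_eq)

abbreviation curve_tpoly :: "bool \<Rightarrow> 'k tpoly" where
  "curve_tpoly j \<equiv> curve q j varX varY varZ"

lemma
  assumes "{a, b, c, d, e, f, g} \<subseteq> F" "a * d - b * c \<noteq> 0" "g \<noteq> 0"
  shows xysubst_curve_tpoly: "xysubst (curve_tpoly j) a b c d e f g = curve_tpoly j"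
    and xysubst_dickson_N:
      "xysubst (dickson_N q varX varY varZ) a b c d e f g = tconst g * dickson_N q varX varY varZ"
proof -
  interpret t: comm_ring_hom "tconst :: 'k \<Rightarrow> _" by (rule comm_ring_hom_tconst)
  have "tconst a * tconst d - tconst b * tconst c \<noteq> 0"
    using assms(2) by (simp flip: t.hom_mult t.hom_minus)
  moreover have "tconst g \<noteq> 0" using assms by simp
  ultimately show
    "xysubst (curve_tpoly j) a b c d e f g = curve_tpoly j"
    "xysubst (dickson_N q varX varY varZ) a b c d e f g = tconst g * dickson_N q varX varY varZ"
    unfolding xysubst_def hom_dickson[OF comm_ring_hom_tsubst] tsubst_simps
    using assms(1) dickson_D_nonzero
    by (simp_all add: curve_linear_change dickson_linear_change CHAR_K tconst_F)
qed

lemma curve_tpoly_invariant: "curve_invariant AGL0 (curve_tpoly j)"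
  unfolding curve_invariant_def
proof
  fix M assume "M \<in> AGL0"
  then obtain a b c d e f g where "M = lower_block a b c d e f g" "{a, b, c, d, e, f, g} \<subseteq> F"
    "a * d - b * c \<noteq> 0" "g \<noteq> 0" by (rule AGLbar_axis_lower_block)
  then have "mat_act M (curve_tpoly j) = tconst 1 * curve_tpoly j"
    by (simp add: mat_act_lower_block xysubst_curve_tpoly tconst_mult)
  then show "\<exists>c. c \<noteq> 0 \<and> mat_act M (curve_tpoly j) = tconst c * curve_tpoly j"
    by (metis one_neq_zero)
qed

text \<open>The maps concerned generate the group of order q^2(q-1) fixing every line through (0 : 0
  : 1). Invariance is exact, not up to scalars, so that it survives linear combinations with
  coefficients free of Z.\<close>

definition axial_invariant :: "'k tpoly \<Rightarrow> bool" where
  "axial_invariant G \<longleftrightarrow> (\<forall>a\<in>F. \<forall>b\<in>F. G \<circ>\<^sub>p [:[:[:0, a:], [:b:]:], 1:] = G) \<and>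
     (\<forall>t\<in>F. t \<noteq> 0 \<longrightarrow> G \<circ>\<^sub>p [:0, [:[:t:]:]:] = G)"

lemma xysubst_translate: "xysubst (G :: 'k tpoly) 1 0 0 1 a b 1 = G \<circ>\<^sub>p [:[:[:0, a:], [:b:]:], 1:]"
proof -
  have "tconst a * varX + tconst b * varY + tconst 1 * varZ = [:[:[:0, a:], [:b:]:], 1:]"
    by (simp add: tconst_def varX_def varY_def varZ_def)
  moreover have "tconst 1 * varX + tconst 0 * varY = (varX :: 'k tpoly)"
    "tconst 0 * varX + tconst 1 * varY = (varY :: 'k tpoly)"
    by (simp_all add: tconst_def)
  ultimately show ?thesis by (simp only: xysubst_def tsubst_pcompose)
qed

lemma xysubst_scale: "xysubst (G :: 'k tpoly) 1 0 0 1 0 0 t = G \<circ>\<^sub>p [:0, [:[:t:]:]:]"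
proof -
  have "tconst 0 * varX + tconst 0 * varY + tconst t * varZ = [:0, [:[:t:]:]:]"
    by (simp add: tconst_def varX_def varY_def varZ_def)
  moreover have "tconst 1 * varX + tconst 0 * varY = (varX :: 'k tpoly)"
    "tconst 0 * varX + tconst 1 * varY = (varY :: 'k tpoly)"
    by (simp_all add: tconst_def)
  ultimately show ?thesis by (simp only: xysubst_def tsubst_pcompose)
qed

lemma axial_invariantI:
  assumes tr: "\<And>a b. a \<in> F \<Longrightarrow> b \<in> F \<Longrightarrow> \<exists>k. xysubst G 1 0 0 1 a b 1 = tconst k * G"
    and sc: "\<And>t. t \<in> F \<Longrightarrow> t \<noteq> 0 \<Longrightarrow> \<exists>k. xysubst G 1 0 0 1 0 0 t = tconst k * G"
    and G0: "coeff G 0 \<noteq> 0"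
  shows "axial_invariant G"
  unfolding axial_invariant_def
proof (intro conjI ballI impI)
  fix a b assume "a \<in> F" "b \<in> F"
  then obtain k where k: "G \<circ>\<^sub>p [:[:[:0, a:], [:b:]:], 1:] = smult [:[:k:]:] G"
    using tr[of a b] by (auto simp: xysubst_translate tconst_mult)
  have "lead_coeff (G \<circ>\<^sub>p [:[:[:0, a:], [:b:]:], 1:]) = lead_coeff G"
    by (subst lead_coeff_comp) simp_all
  then have "[:[:k:]:] * lead_coeff G = 1 * lead_coeff G" unfolding k lead_coeff_smult by simp
  then have "[:[:k:]:] = 1" using G0 by (metis mult_right_cancel leading_coeff_0_iff coeff_0)
  then show "G \<circ>\<^sub>p [:[:[:0, a:], [:b:]:], 1:] = G" using k by simp
next
  fix t assume "t \<in> F" "t \<noteq> 0"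
  then obtain k where k: "G \<circ>\<^sub>p [:0, [:[:t:]:]:] = smult [:[:k:]:] G"
    using sc[of t] by (auto simp: xysubst_scale tconst_mult)
  have "coeff (G \<circ>\<^sub>p [:0, [:[:t:]:]:]) 0 = coeff G 0"
    by (simp add: pcompose_coeff_0 poly_0_coeff_0)
  then have "[:[:k:]:] * coeff G 0 = 1 * coeff G 0" unfolding k coeff_smult by simp
  then have "[:[:k:]:] = 1" using G0 by (metis mult_right_cancel)
  then show "G \<circ>\<^sub>p [:0, [:[:t:]:]:] = G" using k by simp
qed

text \<open>The q^2 translations give the divisor q^2. Scaling Z by t multiplies the leading
  coefficient by t^(degree G), which gives q - 1; the two divisors are coprime.\<close>

lemma axial_invariant_degree:
  assumes "axial_invariant G"
  shows "q ^ 2 * (q - 1) dvd degree G"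
proof (cases "G = 0")
  case False
  define V where "V = (\<lambda>(a, b). [:[:0, a:], [:b:]:]) ` (F \<times> F)"
  have inj: "inj_on (\<lambda>(a, b). [:[:0, a:], [:b:]:]) (F \<times> F)" by (auto simp: inj_on_def)
  have cardV: "card V = q ^ 2"
    unfolding V_def card_image[OF inj] by (simp add: card_cartesian_product card_F power2_eq_square)
  have "card V dvd degree G"
  proof (rule card_dvd_degree_of_translation_invariant)
    show "finite V" by (simp add: V_def)
    show "0 \<in> V" unfolding V_def by (rule image_eqI[of _ _ "(0, 0)"]) auto
    show "u + v \<in> V" if uv: "u \<in> V" "v \<in> V" for u v
    proof -
      obtain a b c d where "a \<in> F" "b \<in> F" "c \<in> F" "d \<in> F" "u = [:[:0, a:], [:b:]:]" "v = [:[:0, c:], [:d:]:]"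
        using uv by (auto simp: V_def)
      then show ?thesis unfolding V_def by (intro image_eqI[of _ _ "(a + c, b + d)"]) auto
    qed
    show "G \<circ>\<^sub>p [:v, 1:] = G" if "v \<in> V" for v
      using that assms by (auto simp: V_def axial_invariant_def)
  qed
  moreover have "(q - 1) dvd degree G"
  proof (rule q_minus_1_dvd_exponent)
    fix t assume t: "t \<in> F" "t \<noteq> 0"
    then have "lead_coeff (G \<circ>\<^sub>p [:0, [:[:t:]:]:]) = lead_coeff G"
      using assms by (simp add: axial_invariant_def)
    then have "lead_coeff G * [:[:t:]:] ^ degree G = lead_coeff G * 1"
      using t by (subst (asm) lead_coeff_comp) auto
    then have "[:[:t:]:] ^ degree G = 1" using False by (metis mult_left_cancel leading_coeff_0_iff)
    moreover have "[:[:t:]:] ^ m = [:[:t ^ m:]:]" for m by (induction m) simp_all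
    ultimately show "t ^ degree G = 1" by simp
  qed
  moreover have "coprime (q ^ 2) (q - 1)"
    using q_gt_0 by (metis coprime_power_left_iff coprime_diff_one_right_nat)
  ultimately show ?thesis using cardV by (simp add: divides_mult)
qed simp

end

subsection \<open>Local analysis at a point of the line Y = 0\<close>

lemma diff_dvd_diff_power: "x - y dvd x ^ m - (y::'r::comm_ring_1) ^ m"
  by (cases m) (simp_all only: diff_power_eq_sum power_0 diff_self dvd_0_right dvd_triv_left)

lemma dvd_diff_power: "S dvd x - y \<Longrightarrow> S dvd x ^ m - (y::'r::comm_ring_1) ^ m"
  using diff_dvd_diff_power dvd_trans by blast

lemma order_power:
  fixes f :: "'r::idom poly"
  assumes "f \<noteq> 0" shows "order a (f ^ m) = m * order a f"
  using assms by (induction m) (simp_all add: order_mult)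

lemma order_0_le:
  fixes f :: "'r::idom poly"
  assumes "coeff f m \<noteq> 0" shows "order 0 f \<le> m"
proof (rule ccontr)
  assume *: "\<not> order 0 f \<le> m"
  have "monom 1 (order 0 f) dvd f" using assms by (subst monom_1_dvd_iff) auto
  then obtain g where "f = monom 1 (order 0 f) * g" ..
  then have "coeff f m = 0" using * by (metis coeff_monom_mult not_le)
  then show False using assms by simp
qed

lemma order_0_pcompose_monom:
  fixes f :: "'r::idom poly"
  assumes "f \<noteq> 0" "k > 0" shows "order 0 (f \<circ>\<^sub>p monom 1 k) = k * order 0 f"
proof -
  obtain g where g: "f = [:- 0, 1:] ^ order 0 f * g" "\<not> [:- 0, 1:] dvd g"
    using order_decomp[OF assms(1)] by blast
  have g0: "poly g 0 \<noteq> 0" using g(2) by (simp only: poly_eq_0_iff_dvd) simp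
  have x: "[:- 0, 1:] ^ m = monom (1::'r) m" for m by (simp add: monom_altdef)
  have "f \<circ>\<^sub>p monom 1 k = (monom 1 (order 0 f) \<circ>\<^sub>p monom 1 k) * (g \<circ>\<^sub>p monom 1 k)"
    by (subst g(1)) (simp only: x pcompose_mult)
  also have "monom 1 (order 0 f) \<circ>\<^sub>p monom 1 k = (monom 1 (k * order 0 f) :: 'r poly)"
    by (simp add: monom_altdef[of 1 "order 0 f"] pcompose_hom.hom_power pcompose_pCons monom_power)
  finally have eq: "f \<circ>\<^sub>p monom 1 k = monom 1 (k * order 0 f) * (g \<circ>\<^sub>p monom 1 k)" .
  have "poly (g \<circ>\<^sub>p monom 1 k) 0 \<noteq> 0" using g0 assms(2) by (simp add: poly_pcompose poly_monom power_0_left)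
  then have "order 0 (g \<circ>\<^sub>p monom 1 k) = 0" "g \<circ>\<^sub>p monom 1 k \<noteq> 0"
    by (auto simp: order_0I)
  then show ?thesis unfolding eq by (subst order_mult) auto
qed

context alg_closed_char_p
begin

text \<open>Newton polygon arithmetic for two factors with vertical orders \<open>m\<^sub>i\<close>, horizontal orders \<open>n\<^sub>i\<close> and
  weighted orders \<open>k\<^sub>i\<close>.\<close>

lemma q_dvd_balance:
  assumes "k1 + k2 \<ge> q * (q - 1)" "k1 \<le> (q - 1) * m1" "k2 \<le> (q - 1) * m2"
    and "k1 \<le> q * n1" "k2 \<le> q * n2" "m1 + m2 \<le> q" "n1 + n2 \<le> q - 1" "m1 > 0"
  shows "m2 = 0"
proof -
  obtain r where r: "q = Suc r" using q_gt_0 by (cases q) auto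
  \<comment> \<open>One weighted order is bounded vertically and the other horizontally, in both
    ways. The two lower bounds add up to the upper bound, so both are equalities.\<close>
  have "(q - 1) * m1 + q * n2 \<ge> q * (q - 1)" "q * n1 + (q - 1) * m2 \<ge> q * (q - 1)"
    using assms by linarith+
  moreover have "(q - 1) * (m1 + m2) \<le> (q - 1) * q" "q * (n1 + n2) \<le> q * (q - 1)"
    using assms(6,7) by (intro mult_le_mono2; simp)+
  ultimately have eq: "(q - 1) * m1 + q * n2 = q * (q - 1)"
    unfolding r by (simp add: algebra_simps)
  then have "q dvd (q - 1) * m1"
    by (metis dvd_add_left_iff dvd_triv_left)
  moreover have "coprime q (q - 1)"
    using q_gt_0 by (metis coprime_diff_one_right_nat)
  ultimately have "q dvd m1" by (simp add: coprime_dvd_mult_right_iff)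
  then have "q \<le> m1" using assms(8) by (simp add: dvd_imp_le)
  then show ?thesis using assms(6) by simp
qed

section \<open>Restrictions and weights of the two curves at a point (1 : 0 : z)\<close>

lemma dickson_at_axis:
  shows "dickson_D q 1 (0::'r::comm_ring_1) = 0" "dickson_Q q 1 (0::'r) = 1" "dickson_phi q 1 (0::'r) = 0"
proof -
  show "dickson_D q 1 (0::'r) = 0" "dickson_phi q 1 (0::'r) = 0"
    using q_gt_0 by (simp_all add: dickson_D_def dickson_phi_def power_0_left)
  have "dickson_Q q 1 (0::'r) = (\<Sum>i\<le>q. if i = q then 1 else 0)"
    unfolding dickson_Q_def using q_gt_1 by (intro sum.cong) (auto simp: power_0_left)
  then show "dickson_Q q 1 (0::'r) = 1" by simp
qed

text \<open>On Y = 0 the invariant D vanishes and Q is 1, so both curves have the same restriction,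
  a q-th power.\<close>

lemma curve_at_axis:
  fixes z :: "'r::comm_ring_1"
  assumes "CHAR('r) = p"
  shows "curve q j 1 0 z = (dickson_phi q 1 z ^ (q - 1) - 1) ^ q"
proof -
  have "dickson_N q 1 0 z = dickson_phi q 1 z ^ q"
    using q_gt_1 by (simp add: dickson_N_def dickson_at_axis power_0_left)
  then have "pencil q 1 0 z = (dickson_phi q 1 z ^ q) ^ (q - 1) - 1"
    by (simp add: pencil_def dickson_at_axis)
  also have "\<dots> = (dickson_phi q 1 z ^ (q - 1) - 1) ^ q"
    by (simp add: frob_diff[OF assms] mult.commute flip: power_mult)
  finally have "pencil q 1 0 z = \<dots>" .
  moreover have "(0::'r) ^ (q * (q - 1)) = 0" using q_gt_1 by (simp add: power_0_left)
  ultimately show ?thesis by (simp add: curve_def dickson_at_axis)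
qed

lemma dickson_phi_1_add:
  fixes z w :: "'r::comm_ring_1"
  assumes "CHAR('r) = p"
  shows "dickson_phi q 1 (z + w) = dickson_phi q 1 z + (w ^ q - w)"
  by (simp add: dickson_phi_def frob_add[OF assms])

text \<open>The weights are \<open>q\<close> for \<open>y\<close> and \<open>q - 1\<close> for \<open>w\<close>, so that \<open>y\<^bsup>q-1\<^esup>\<close> and \<open>w\<^sup>q\<close> both have
  weight \<open>q(q - 1)\<close>.\<close>

lemma curve_weight:
  fixes S y z w :: "'r::comm_ring_1"
  assumes ch: "CHAR('r) = p" and S: "S dvd y ^ (q - 1)" "S dvd w ^ q"
    and z: "dickson_phi q 1 z ^ q = dickson_phi q 1 z" "dickson_phi q 1 z ^ (q - 1) = 1"
  shows "S dvd curve q j 1 y (z + w)"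
proof -
  define c where "c = dickson_phi q 1 z"
  have "dickson_phi q 1 y = y * (y ^ (q - 1) - 1)"
    using q_gt_0 by (simp add: dickson_phi_def right_diff_distrib flip: power_Suc)
  then have "S dvd dickson_phi q 1 y ^ (q - 1)" using S(1) by (simp add: power_mult_distrib)
  moreover have "dickson_phi q 1 (z + w) ^ q - c = (w ^ q) ^ q - w ^ q"
    using z by (simp add: dickson_phi_1_add[OF ch] frob_add[OF ch] frob_diff[OF ch] c_def)
  moreover have "S dvd (w ^ q) ^ q - w ^ q"
    using S(2) q_gt_0 by (metis dvd_diff dvd_power dvd_trans)
  ultimately have "S dvd (dickson_phi q 1 (z + w) ^ q - c) - dickson_phi q 1 (z + w) * dickson_phi q 1 y ^ (q - 1)"
    by (metis dvd_diff dvd_mult)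
  \<comment> \<open>Modulo S, N is the constant c with c^(q-1) = 1, and Q turns out to be 1, so the
    two terms of the pencil cancel.\<close>
  then have "S dvd dickson_N q 1 y (z + w) - c" by (simp add: dickson_N_def algebra_simps)
  then have N: "S dvd dickson_N q 1 y (z + w) ^ (q - 1) - 1"
    using dvd_diff_power[of S _ c "q - 1"] z(2) by (simp add: c_def)
  have "dickson_Q q 1 y = (\<Sum>i<q. (y ^ (q - 1)) ^ (q - i)) + 1"
    by (simp add: dickson_Q_def flip: lessThan_Suc_atMost)
  moreover have "S dvd (\<Sum>i<q. (y ^ (q - 1)) ^ (q - i))"
    by (rule dvd_sum) (use S(1) in \<open>metis dvd_power dvd_trans lessThan_iff zero_less_diff\<close>)
  ultimately have "S dvd dickson_Q q 1 y - 1" by simp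
  then have Q: "S dvd dickson_Q q 1 y ^ q - 1" using dvd_diff_power[of S _ 1 q] by simp
  have P: "S dvd pencil q 1 y (z + w)" using dvd_diff[OF N Q] by (simp add: pencil_def)
  have "y dvd dickson_D q 1 y" using q_gt_0 by (simp add: dickson_D_def dvd_power)
  then have "y ^ (q - 1) dvd dickson_D q 1 y ^ (q - 1)" by (rule dvd_power_same)
  then have "S dvd dickson_D q 1 y ^ (q - 1)" using S(1) dvd_trans by blast
  then have "S dvd dickson_D q 1 y ^ (q * (q - 1))"
    using q_gt_0 by (subst mult.commute) (metis dvd_power dvd_trans power_mult)
  then show ?thesis using P by (simp add: curve_def)
qed

lemma order_curve_along_axis:
  assumes z: "dickson_phi q 1 z ^ q = dickson_phi q 1 z"
  shows "curve q j 1 0 [:z, 1::'k:] \<noteq> 0" "order 0 (curve q j 1 0 [:z, 1::'k:]) \<le> q"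
proof -
  define u where "u = dickson_phi q 1 [:z, 1:]"
  have "[:z, 1:] = [:z:] + monom 1 1" by (simp add: monom_altdef)
  then have u: "u = [:dickson_phi q 1 z:] + (monom 1 q - monom 1 1)"
    unfolding u_def using dickson_phi_1_add[OF CHAR_poly, of "[:z:]" "monom 1 1"]
      hom_dickson(3)[OF comm_ring_hom_const, of q 1 z]
    by (simp add: monom_power)
  have "u ^ q = [:dickson_phi q 1 z:] + (monom 1 (q * q) - monom 1 q)"
    unfolding u frob_add[OF CHAR_poly] frob_diff[OF CHAR_poly]
    using z by (simp add: monom_power poly_const_pow)
  moreover have "q * q > 1" using one_less_mult q_gt_1 by simp
  ultimately have "coeff (u ^ q) 1 = 0" using q_gt_1 by simp
  moreover have "coeff u 1 = - 1" unfolding u using q_gt_1 by simp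
  ultimately have c1: "coeff (u ^ q - u) 1 = 1" unfolding coeff_diff by simp
  \<comment> \<open>multiplying \<open>u\<^bsup>q-1\<^esup> - 1\<close> by \<open>u\<close> makes it additive in \<open>w\<close>\<close>
  have uq: "u ^ q - u = u * (u ^ (q - 1) - 1)"
    using q_gt_0 by (simp add: right_diff_distrib flip: power_Suc)
  then have nz: "u * (u ^ (q - 1) - 1) \<noteq> 0" using c1 by auto
  have "order 0 (u * (u ^ (q - 1) - 1)) \<le> 1"
    using order_0_le[of "u ^ q - u" 1] c1 uq by simp
  then have "order 0 (u ^ (q - 1) - 1) \<le> 1" unfolding order_mult[OF nz] by linarith
  moreover have eq: "curve q j 1 0 [:z, 1:] = (u ^ (q - 1) - 1) ^ q"
    unfolding curve_at_axis[OF CHAR_poly] u_def ..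
  ultimately show "order 0 (curve q j 1 0 [:z, 1:]) \<le> q" "curve q j 1 0 [:z, 1:] \<noteq> 0"
    using nz by (simp_all add: order_power)
qed

text \<open>On the line Z = zX, the lowest term of the pencil comes from \<psi>, of order q - 1; all
  other contributions have order at least q.\<close>

lemma order_curve_transversal:
  assumes z: "dickson_phi q 1 z ^ q = dickson_phi q 1 z" "dickson_phi q 1 z ^ (q - 1) = 1"
  shows "curve q j 1 [:0, 1:] [:z::'k:] \<noteq> 0" "order 0 (curve q j 1 [:0, 1:] [:z::'k:]) \<le> q - 1"
proof -
  define y :: "'k poly" where "y = [:0, 1:]"
  define \<psi> where "\<psi> = dickson_phi q 1 y ^ (q - 1)"
  define Q where "Q = dickson_Q q 1 y"
  define c where "c = [:dickson_phi q 1 z:]"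
  have c: "c = dickson_phi q 1 [:z:]"
    using hom_dickson(3)[OF comm_ring_hom_const, of q 1 z] by (simp add: c_def)
  have c1: "c ^ q = c" "c ^ (q - 1) = 1" using z by (simp_all add: c_def poly_const_pow)
  have dvd_iff: "y dvd f \<longleftrightarrow> poly f 0 = 0" for f
    unfolding y_def using poly_eq_0_iff_dvd[of f 0] by simp
  have Q0: "poly Q 0 = 1"
    using hom_dickson(2)[OF comm_ring_hom_poly, of q 1 y 0] dickson_at_axis(2) by (simp add: Q_def y_def)
  have nQ: "order 0 Q = 0" "Q \<noteq> 0" using Q0 by (auto simp: order_0I)
  have "dickson_phi q 1 y = y * (y ^ (q - 1) - 1)"
    using q_gt_0 by (simp add: dickson_phi_def right_diff_distrib flip: power_Suc)
  then have \<psi>: "\<psi> = y ^ (q - 1) * (y ^ (q - 1) - 1) ^ (q - 1)" by (simp add: \<psi>_def power_mult_distrib)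
  define e where "e = (y ^ (q - 1) - 1) ^ (q - 1)"
  have "poly e 0 \<noteq> 0" using q_gt_1 by (simp add: e_def y_def power_0_left)
  then have e: "e \<noteq> 0" "order 0 e = 0" by (auto simp: order_0I)
  have ypow: "y ^ (q - 1) \<noteq> 0" "order 0 (y ^ (q - 1)) = q - 1"
    using order_power_n_n[of 0 "q - 1"] by (simp_all add: y_def)
  have n\<psi>: "\<psi> \<noteq> 0" "order 0 \<psi> = q - 1"
    using e ypow unfolding \<psi> e_def[symmetric] by (simp_all add: order_mult)
  have N: "dickson_N q 1 y [:z:] = c * (1 - \<psi>)"
    using c1 by (simp add: dickson_N_def \<psi>_def algebra_simps flip: c)
  \<comment> \<open>The factor 1 - \<psi>, nonzero at y = 0, completes N^(q-1) to a q-th power;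
    Frobenius then separates the terms.\<close>
  have "(1 - \<psi>) * pencil q 1 y [:z:] = (1 - \<psi>) ^ q - Q ^ q * (1 - \<psi>)"
  proof -
    have "dickson_N q 1 y [:z:] ^ (q - 1) = (1 - \<psi>) ^ (q - 1)"
      unfolding N power_mult_distrib c1 by simp
    moreover have "(1 - \<psi>) * (1 - \<psi>) ^ (q - 1) = (1 - \<psi>) ^ q"
      using q_gt_0 by (simp flip: power_Suc)
    ultimately show ?thesis
      unfolding pencil_def Q_def[symmetric] by (metis mult.commute right_diff_distrib)
  qed
  also have "\<dots> = \<psi> * Q ^ q - \<psi> ^ q - (Q - 1) ^ q"
    by (simp add: frob_diff[OF CHAR_poly] algebra_simps)
  finally have key: "(1 - \<psi>) * pencil q 1 y [:z:] = \<psi> * Q ^ q - \<psi> ^ q - (Q - 1) ^ q" .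
  have pw: "y ^ q dvd \<psi> ^ q" "y ^ q dvd (Q - 1) ^ q"
    using Q0 q_gt_1 by (intro dvd_power_same; simp add: dvd_iff \<psi>; simp add: y_def power_0_left)+
  have "\<not> y ^ q dvd \<psi> * Q ^ q"
  proof
    assume "y ^ q dvd \<psi> * Q ^ q"
    then have "q \<le> order 0 (\<psi> * Q ^ q)"
      using n\<psi> nQ order_divides[of 0 q "\<psi> * Q ^ q"] by (simp add: y_def)
    then show False using n\<psi> nQ q_gt_0 by (simp add: order_mult order_power)
  qed
  then have np: "\<not> y ^ q dvd pencil q 1 y [:z:]"
    using key pw by (metis dvd_diff_right_iff dvd_mult dvd_diff_left_iff)
  have "\<not> y ^ q dvd curve q j 1 y [:z:]"
  proof (cases j)
    case True
    have "y dvd dickson_D q 1 y" using q_gt_0 by (simp add: dickson_D_def dvd_power)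
    moreover have "q * (q - 1) \<ge> q" using q_gt_1 by simp
    ultimately have "y ^ q dvd dickson_D q 1 y ^ (q * (q - 1))"
      by (metis dvd_power_le)
    moreover have "\<not> y ^ q dvd Q * pencil q 1 y [:z:]"
    proof
      assume "y ^ q dvd Q * pencil q 1 y [:z:]"
      moreover have "Q * pencil q 1 y [:z:] \<noteq> 0" using np nQ by auto
      ultimately have "q \<le> order 0 (pencil q 1 y [:z:])"
        using nQ order_divides[of 0 q "Q * pencil q 1 y [:z:]"] by (simp add: y_def order_mult)
      then show False using np order_divides[of 0 q "pencil q 1 y [:z:]"] by (simp add: y_def)
    qed
    ultimately show ?thesis using True unfolding curve_def Q_def
      by (metis dvd_diff_left_iff)
  qed (use np in \<open>simp add: curve_def\<close>)
  then show "curve q j 1 [:0, 1:] [:z:] \<noteq> 0" "order 0 (curve q j 1 [:0, 1:] [:z:]) \<le> q - 1"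
    using order_divides[of 0 q "curve q j 1 y [:z:]"] by (auto simp: y_def not_le)
qed

definition axis_eval :: "'k \<Rightarrow> 'k tpoly \<Rightarrow> 'k" where
  "axis_eval z G = tev (\<lambda>c. c) 1 0 z G"

lemma comm_ring_hom_axis_eval: "comm_ring_hom (axis_eval z)"
  unfolding axis_eval_def by (rule comm_ring_hom_tev[OF comm_ring_hom_id])

text \<open>The weighted order is additive over G and R, and in each it is bounded by the order
  along the axis and by the transversal one. The totals are at least q(q-1), at most q and at most q
  - 1, so \<open>q_dvd_balance\<close> leaves no zero for R.\<close>

lemma curve_cofactor_nonzero:
  assumes fac: "curve_tpoly j = G * R" and zero: "axis_eval z G = 0"
  shows "axis_eval z R \<noteq> 0"
proof -
  interpret ae: comm_ring_hom "axis_eval z" by (rule comm_ring_hom_axis_eval)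
  note hc = comm_ring_hom_const[where 'a='k]
  have "axis_eval z (curve_tpoly j) = 0" using fac zero by (simp add: ae.hom_mult)
  then have "curve q j 1 0 z = 0"
    by (simp add: axis_eval_def hom_dickson[OF comm_ring_hom_tev[OF comm_ring_hom_id]] comm_ring_hom_id)
  then have z1: "dickson_phi q 1 z ^ (q - 1) = 1" by (simp add: curve_at_axis[OF CHAR_K])
  have z2: "dickson_phi q 1 z ^ q = dickson_phi q 1 z"
    using z1 q_gt_0 by (metis power_minus_mult mult_1)
  define ew where "ew = tev (\<lambda>c. [:c:]) 1 0 [:z, 1::'k:]"
  define ey where "ey = tev (\<lambda>c. [:c:]) 1 [:0, 1:] [:z::'k:]"
  \<comment> \<open>A weighted blow-up: \<open>varZ\<close> is the weight parameter s, with y = s^q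
    Y and w = s^(q-1) X. The weighted order of H is the order of \<open>E H\<close> in
    \<open>varZ\<close>.\<close>
  define E where "E = tev tconst 1 (varZ ^ q * varY) (tconst z + varZ ^ (q - 1) * varX :: 'k tpoly)"
  interpret ew: comm_ring_hom ew unfolding ew_def by (rule comm_ring_hom_tev[OF hc])
  interpret ey: comm_ring_hom ey unfolding ey_def by (rule comm_ring_hom_tev[OF hc])
  interpret E: comm_ring_hom E unfolding E_def by (rule comm_ring_hom_tev[OF comm_ring_hom_tconst])
  have Cw: "ew (curve_tpoly j) = curve q j 1 0 [:z, 1:]"
    unfolding ew_def by (simp add: hom_dickson[OF comm_ring_hom_tev[OF hc]] hc)
  have Cy: "ey (curve_tpoly j) = curve q j 1 [:0, 1:] [:z:]"
    unfolding ey_def by (simp add: hom_dickson[OF comm_ring_hom_tev[OF hc]] hc del:)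
  have CE: "varZ ^ (q * (q - 1)) dvd E (curve_tpoly j)"
  proof -
    have "dickson_phi q 1 (tconst z) = tconst (dickson_phi q 1 z)"
      using hom_dickson(3)[OF comm_ring_hom_tconst, of q 1 z] by (simp add: tconst_def)
    then have "dickson_phi q 1 (tconst z) ^ q = dickson_phi q 1 (tconst z)"
      "dickson_phi q 1 (tconst z) ^ (q - 1) = 1"
      using z1 z2 by (simp_all add: tconst_def poly_const_pow)
    moreover have "varZ ^ (q * (q - 1)) dvd (varZ ^ q * varY :: 'k tpoly) ^ (q - 1)"
      "varZ ^ (q * (q - 1)) dvd (varZ ^ (q - 1) * varX :: 'k tpoly) ^ q"
      by (simp_all add: power_mult_distrib mult.commute flip: power_mult)
    moreover have "E (curve_tpoly j) = curve q j 1 (varZ ^ q * varY) (tconst z + varZ ^ (q - 1) * varX)"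
      unfolding E_def by (simp add: hom_dickson[OF comm_ring_hom_tev[OF comm_ring_hom_tconst]] comm_ring_hom_tconst)
    ultimately show ?thesis using curve_weight[OF CHAR_tpoly] by metis
  qed
  define X1 where "X1 = [:0, 1::'k:]"
  \<comment> \<open>Specialising X and Y can only raise the order in s.\<close>
  have le: "order 0 (E H) \<le> order 0 (tev (\<lambda>c. [:c:]) a b X1 (E H))"
    if "tev (\<lambda>c. [:c:]) a b X1 (E H) \<noteq> 0" for a b H
  proof -
    interpret t: comm_ring_hom "tev (\<lambda>c. [:c:]) a b X1" by (rule comm_ring_hom_tev[OF hc])
    have "[:- 0, 1:] ^ order 0 (E H) dvd E H" by (rule order_1)
    then obtain T where "E H = varZ ^ order 0 (E H) * T" by (auto simp: varZ_def elim!: dvdE)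
    then have "tev (\<lambda>c. [:c:]) a b X1 (E H) = X1 ^ order 0 (E H) * tev (\<lambda>c. [:c:]) a b X1 T"
      using tev_simps(4)[OF hc] by (metis t.hom_mult t.hom_power)
    then have "[:- 0, 1:] ^ order 0 (E H) dvd tev (\<lambda>c. [:c:]) a b X1 (E H)"
      unfolding X1_def by (metis dvd_triv_left minus_zero)
    then show ?thesis using that by (simp only: order_divides) simp
  qed
  have x_pow: "X1 ^ m = monom 1 m" for m by (simp add: X1_def monom_altdef)
  \<comment> \<open>X = 1, Y = 0 restricts to the axis with w = s^(q-1), so orders there are
    multiplied by q - 1. Below, X = 0, Y = 1 gives the transversal line with factor q.\<close>
  have compw: "tev (\<lambda>c. [:c:]) 1 0 X1 (E H) = ew H \<circ>\<^sub>p monom 1 (q - 1)" for H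
  proof -
    interpret t: comm_ring_hom "tev (\<lambda>c. [:c:]) 1 0 X1" by (rule comm_ring_hom_tev[OF hc])
    have "(\<lambda>H. tev (\<lambda>c. [:c:]) 1 0 X1 (E H)) = (\<lambda>H. ew H \<circ>\<^sub>p monom 1 (q - 1))"
      by (rule tpoly_hom_eqI[OF comm_ring_hom_comp[OF t.comm_ring_hom_axioms E.comm_ring_hom_axioms]
            comm_ring_hom_comp[OF comm_ring_hom_pcompose ew.comm_ring_hom_axioms]])
        (simp_all add: E_def ew_def hc comm_ring_hom_tconst t.hom_mult t.hom_add t.hom_power
          pcompose_pCons x_pow)
    then show ?thesis unfolding fun_eq_iff by blast
  qed
  have compy: "tev (\<lambda>c. [:c:]) 0 1 X1 (E H) = ey H \<circ>\<^sub>p monom 1 q" for H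
  proof -
    interpret t: comm_ring_hom "tev (\<lambda>c. [:c:]) 0 1 X1" by (rule comm_ring_hom_tev[OF hc])
    have "(\<lambda>H. tev (\<lambda>c. [:c:]) 0 1 X1 (E H)) = (\<lambda>H. ey H \<circ>\<^sub>p monom 1 q)"
      by (rule tpoly_hom_eqI[OF comm_ring_hom_comp[OF t.comm_ring_hom_axioms E.comm_ring_hom_axioms]
            comm_ring_hom_comp[OF comm_ring_hom_pcompose ey.comm_ring_hom_axioms]])
        (simp_all add: E_def ey_def hc comm_ring_hom_tconst t.hom_mult t.hom_add t.hom_power
          pcompose_pCons x_pow)
    then show ?thesis unfolding fun_eq_iff by blast
  qed
  have nz: "ew (curve_tpoly j) \<noteq> 0" "ey (curve_tpoly j) \<noteq> 0"
    unfolding Cw Cy using order_curve_along_axis(1)[OF z2] order_curve_transversal(1)[OF z2 z1] by auto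
  then have nzf: "ew G \<noteq> 0" "ew R \<noteq> 0" "ey G \<noteq> 0" "ey R \<noteq> 0"
    by (auto simp: fac ew.hom_mult ey.hom_mult)
  have bounds: "order 0 (E H) \<le> (q - 1) * order 0 (ew H)" "order 0 (E H) \<le> q * order 0 (ey H)" "E H \<noteq> 0"
    if H: "ew H \<noteq> 0" "ey H \<noteq> 0" for H
  proof -
    have 1: "ew H \<circ>\<^sub>p monom 1 (q - 1) \<noteq> 0" "ey H \<circ>\<^sub>p monom 1 q \<noteq> 0"
      using H q_gt_1 by (auto simp: pcompose_eq_0_iff degree_monom_eq)
    show "order 0 (E H) \<le> (q - 1) * order 0 (ew H)"
      using le[of 1 0 H] 1 q_gt_1 by (simp add: compw order_0_pcompose_monom H del: One_nat_def)
    show "order 0 (E H) \<le> q * order 0 (ey H)"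
      using le[of 0 1 H] 1 q_gt_1 by (simp add: compy order_0_pcompose_monom H del: One_nat_def)
    show "E H \<noteq> 0"
    proof
      assume "E H = 0"
      interpret t: comm_ring_hom "tev (\<lambda>c. [:c:]) 1 0 X1" by (rule comm_ring_hom_tev[OF hc])
      show False using compw[of H] 1 \<open>E H = 0\<close> by simp
    qed
  qed
  have "q * (q - 1) \<le> order 0 (E (curve_tpoly j))"
  proof -
    have "[:- 0, 1:] ^ (q * (q - 1)) dvd E (curve_tpoly j)" using CE by (simp add: varZ_def)
    then show ?thesis using bounds(3)[OF nz] by (simp only: order_divides) simp
  qed
  moreover have "order 0 (E (curve_tpoly j)) = order 0 (E G) + order 0 (E R)"
    using bounds(3)[OF nz] unfolding fac E.hom_mult by (rule order_mult)
  moreover have "order 0 (ew G) + order 0 (ew R) \<le> q"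
    using order_curve_along_axis(2)[OF z2, of j] nz(1)
    unfolding Cw[symmetric] fac ew.hom_mult by (simp add: order_mult)
  moreover have "order 0 (ey G) + order 0 (ey R) \<le> q - 1"
    using order_curve_transversal(2)[OF z2 z1, of j] nz(2)
    unfolding Cy[symmetric] fac ey.hom_mult by (simp add: order_mult)
  moreover have ew0: "poly (ew H) 0 = axis_eval z H" for H
    unfolding ew_def axis_eval_def hom_tev[OF comm_ring_hom_poly hc] by simp
  moreover have "order 0 (ew G) > 0" using nzf(1) ew0[of G] zero by (simp add: order_gt_0_iff)
  ultimately have "order 0 (ew R) = 0"
    using q_dvd_balance[of "order 0 (E G)" "order 0 (E R)" "order 0 (ew G)" "order 0 (ew R)" "order 0 (ey G)" "order 0 (ey R)"]
      bounds(1,2)[OF nzf(1,3)] bounds(1,2)[OF nzf(2,4)] by simp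
  then show ?thesis using ew0[of R] nzf(2) by (simp add: order_eq_0_iff)
qed

end

subsection \<open>Homogeneous polynomials\<close>

definition hdeg :: "'a::zero tpoly \<Rightarrow> nat \<Rightarrow> bool" where
  "hdeg G d \<longleftrightarrow> (\<forall>i j k. tcoeff G i j k \<noteq> 0 \<longrightarrow> i + j + k = d)"

lemma homogeneous_iff_hdeg: "homogeneous_of_degree G d \<longleftrightarrow> G \<noteq> 0 \<and> hdeg G d"
  by (simp add: homogeneous_of_degree_def hdeg_def)

lemma hdeg_0: "hdeg 0 d" by (simp add: hdeg_def tcoeff_def)

lemma hdeg_add: "hdeg G d \<Longrightarrow> hdeg H d \<Longrightarrow> hdeg (G + H) d"
proof -
  have "tcoeff (G + H) i j k \<noteq> 0 \<Longrightarrow> tcoeff G i j k \<noteq> 0 \<or> tcoeff H i j k \<noteq> 0" for i j k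
    by (auto simp: tcoeff_def)
  then show "hdeg G d \<Longrightarrow> hdeg H d \<Longrightarrow> hdeg (G + H) d" unfolding hdeg_def by blast
qed

lemma hdeg_uminus: "hdeg (G :: 'a::ab_group_add tpoly) d \<Longrightarrow> hdeg (- G) d"
  by (simp add: hdeg_def tcoeff_def)

lemma hdeg_diff: "hdeg (G :: 'a::ab_group_add tpoly) d \<Longrightarrow> hdeg H d \<Longrightarrow> hdeg (G - H) d"
  using hdeg_add[of G d "- H"] hdeg_uminus[of H d] by simp

lemma hdeg_sum: "(\<And>i. i \<in> I \<Longrightarrow> hdeg (f i) d) \<Longrightarrow> hdeg (sum f I) d"
  by (induction I rule: infinite_finite_induct) (auto simp: hdeg_0 hdeg_add)

lemma hdeg_mult:
  fixes G H :: "'a::comm_ring_1 tpoly"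
  assumes G: "hdeg G d" and H: "hdeg H e"
  shows "hdeg (G * H) (d + e)"
  unfolding hdeg_def
proof (intro allI impI)
  fix i j k assume nz: "tcoeff (G * H) i j k \<noteq> 0"
  have eq: "tcoeff (G * H) i j k =
      (\<Sum>k'\<le>k. \<Sum>j'\<le>j. \<Sum>i'\<le>i. tcoeff G i' j' k' * tcoeff H (i - i') (j - j') (k - k'))"
    by (simp add: tcoeff_def coeff_mult coeff_sum)
  obtain k' where k': "k' \<le> k" and "(\<Sum>j'\<le>j. \<Sum>i'\<le>i. tcoeff G i' j' k' * tcoeff H (i - i') (j - j') (k - k')) \<noteq> 0"
    using nz unfolding eq by (metis (no_types, lifting) sum.neutral atMost_iff)
  then obtain j' where j': "j' \<le> j" and "(\<Sum>i'\<le>i. tcoeff G i' j' k' * tcoeff H (i - i') (j - j') (k - k')) \<noteq> 0"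
    by (metis (no_types, lifting) sum.neutral atMost_iff)
  then obtain i' where i': "i' \<le> i" and "tcoeff G i' j' k' * tcoeff H (i - i') (j - j') (k - k') \<noteq> 0"
    by (metis (no_types, lifting) sum.neutral atMost_iff)
  then have "tcoeff G i' j' k' \<noteq> 0" "tcoeff H (i - i') (j - j') (k - k') \<noteq> 0" by auto
  then have "i' + j' + k' = d" "(i - i') + (j - j') + (k - k') = e"
    using G H by (auto simp: hdeg_def)
  then show "i + j + k = d + e" using i' j' k' by simp
qed

lemma hdeg_tconst: "hdeg (tconst c) 0"
  by (auto simp: hdeg_def tcoeff_def tconst_def coeff_pCons split: nat.splits)

lemma hdeg_1: "hdeg (1 :: 'a::comm_ring_1 tpoly) 0"
  using hdeg_tconst[of "1::'a"] by (simp add: tconst_def)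

lemma hdeg_power:
  fixes G :: "'a::comm_ring_1 tpoly"
  shows "hdeg G d \<Longrightarrow> hdeg (G ^ m) (m * d)"
  by (induction m) (auto simp: hdeg_1 hdeg_mult)

lemma hdeg_vars:
  "hdeg (varX :: 'a::comm_ring_1 tpoly) 1" "hdeg (varY :: 'a tpoly) 1" "hdeg (varZ :: 'a tpoly) 1"
  by (auto simp: hdeg_def tcoeff_def varX_def varY_def varZ_def coeff_pCons coeff_1 split: nat.splits if_splits)

lemma hdeg_linform: "hdeg (linform M i) 1"
  unfolding linform_def
  by (intro hdeg_add; rule hdeg_mult[OF hdeg_tconst, where e = 1, unfolded add_0]; rule hdeg_vars)

lemma hdeg_mat_act:
  assumes "hdeg G d" shows "hdeg (mat_act M G) d"
  unfolding mat_act_def tsubst_def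
proof (intro hdeg_sum)
  fix k j i
  show "hdeg (tconst (tcoeff G i j k) * linform M 1 ^ i * linform M 2 ^ j * linform M 3 ^ k) d"
  proof (cases "tcoeff G i j k = 0")
    case True then show ?thesis by (simp add: tconst_def hdeg_0)
  next
    case False
    then have "i + j + k = d" using assms by (simp add: hdeg_def)
    moreover have "hdeg (tconst (tcoeff G i j k) * linform M 1 ^ i * linform M 2 ^ j * linform M 3 ^ k)
        (0 + i * 1 + j * 1 + k * 1)"
      by (intro hdeg_mult hdeg_tconst hdeg_power hdeg_linform)
    ultimately show ?thesis by simp
  qed
qed

text \<open>The grading, seen as the substitution \<open>(X, Y, Z) \<mapsto> (sX, sY, sZ)\<close> with a new variable \<open>s\<close>.\<close>

definition grade :: "'a::comm_ring_1 tpoly \<Rightarrow> 'a tpoly poly" where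
  "grade = tev (\<lambda>c. [:tconst c:]) [:0, varX:] [:0, varY:] [:0, varZ:]"

lemma comm_ring_hom_tconst_const: "comm_ring_hom (\<lambda>c. [:tconst c:])"
  by (rule comm_ring_hom_comp[OF comm_ring_hom_const comm_ring_hom_tconst])

lemma comm_ring_hom_grade: "comm_ring_hom grade"
  unfolding grade_def by (rule comm_ring_hom_tev[OF comm_ring_hom_tconst_const])

lemma poly_grade: "poly (grade G) (tconst t) = tsubst G (tconst t * varX) (tconst t * varY) (tconst t * varZ)"
  unfolding grade_def hom_tev[OF comm_ring_hom_poly comm_ring_hom_tconst_const]
  by (simp add: tsubst_eq_tev)

lemma grade_hdeg:
  assumes "hdeg G d" shows "grade G = monom G d"
proof -
  interpret g: comm_ring_hom "grade :: 'a tpoly \<Rightarrow> _" by (rule comm_ring_hom_grade)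
  have mono: "grade (tconst c * varX ^ i * varY ^ j * varZ ^ k) = monom (tconst c * varX ^ i * varY ^ j * varZ ^ k) (i + j + k)"
    for c :: 'a and i j k
  proof -
    have m: "[:0, v:] ^ i = monom (v ^ i) i" for v :: "'a tpoly" and i
    proof -
      have "[:0, v:] = monom v 1" by (simp add: monom_altdef)
      then show ?thesis by (simp add: monom_power)
    qed
    have "grade (tconst c) = monom (tconst c) 0"
      by (simp add: grade_def comm_ring_hom_tconst_const monom_0)
    then show ?thesis
      by (simp add: g.hom_mult g.hom_power mult_monom m
        tev_simps[OF comm_ring_hom_tconst_const, of "[:0, varX:]" "[:0, varY:]" "[:0, varZ:]", folded grade_def])
  qed
  let ?T = "\<lambda>k j i. tconst (tcoeff G i j k) * varX ^ i * varY ^ j * varZ ^ k"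
  have T: "grade (?T k j i) = monom (?T k j i) d" for k j i
    using assms unfolding mono hdeg_def by (cases "tcoeff G i j k = 0") (auto simp: tconst_def)
  have G: "G = (\<Sum>k\<le>degree G. \<Sum>j\<le>degree (coeff G k). \<Sum>i\<le>degree (coeff (coeff G k) j). ?T k j i)"
    using tsubst_id[of G] by (simp add: tsubst_def)
  have "grade G = (\<Sum>k\<le>degree G. \<Sum>j\<le>degree (coeff G k). \<Sum>i\<le>degree (coeff (coeff G k) j). monom (?T k j i) d)"
    by (subst G) (simp only: g.hom_sum T)
  also have "\<dots> = monom G d"
    by (subst (4) G) (simp add: monom_hom.hom_sum)
  finally show ?thesis .
qed

text \<open>The order at 0 and the degree both add up to d over the factors; as the order never
  exceeds the degree, they agree in each factor.\<close>

lemma monom_factor: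
  fixes P R :: "'r::idom poly"
  assumes "P * R = monom c d" "c \<noteq> 0"
  obtains b k where "P = monom b k"
proof -
  have nz: "P * R \<noteq> 0" using assms by simp
  then have "order 0 P + order 0 R = d" using assms order_mult[OF nz, of 0] by simp
  moreover have "degree P + degree R = d"
  proof -
    have "P \<noteq> 0" "R \<noteq> 0" using nz by auto
    then show ?thesis using assms degree_mult_eq[of P R] by (simp add: degree_monom_eq)
  qed
  moreover have "order 0 P \<le> degree P" "order 0 R \<le> degree R" using nz by (auto intro: order_degree)
  ultimately have ord: "order 0 P = degree P" by simp
  have "P = monom (lead_coeff P) (degree P)"
  proof (rule poly_eqI)
    fix i
    have "coeff P i = 0" if "i < degree P"
    proof -
      have "monom 1 (degree P) dvd P" using nz ord by (subst monom_1_dvd_iff) auto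
      then obtain g where "P = monom 1 (degree P) * g" ..
      then show ?thesis using that by (metis coeff_monom_mult not_le)
    qed
    then show "coeff P i = coeff (monom (lead_coeff P) (degree P)) i"
      by (cases i "degree P" rule: linorder_cases) (auto simp: coeff_eq_0)
  qed
  then show thesis by (rule that)
qed

text \<open>A factor of a homogeneous polynomial is homogeneous, because its image under
  \<open>grade\<close> divides a monomial. The form used later is that scalar matrices act on it by
  scalars.\<close>

lemma hdeg_factor_scale:
  fixes G R :: "'a::idom tpoly"
  assumes "hdeg (G * R) d" "G * R \<noteq> 0"
  shows "\<exists>k. tsubst G (tconst t * varX) (tconst t * varY) (tconst t * varZ) = tconst (t ^ k) * G"
proof -
  interpret g: comm_ring_hom "grade :: 'a tpoly \<Rightarrow> _" by (rule comm_ring_hom_grade)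
  interpret t: comm_ring_hom "tconst :: 'a \<Rightarrow> _" by (rule comm_ring_hom_tconst)
  have "grade G * grade R = monom (G * R) d" using grade_hdeg[OF assms(1)] by (simp add: g.hom_mult)
  then obtain b k where b: "grade G = monom b k" using assms(2) by (rule monom_factor)
  have "poly (grade G) (tconst 1) = G" unfolding poly_grade by (simp add: t.hom_one)
  then have "b = G" by (simp add: b poly_monom t.hom_one)
  then have "tsubst G (tconst t * varX) (tconst t * varY) (tconst t * varZ) = G * tconst t ^ k"
    by (simp flip: poly_grade add: b poly_monom)
  then show ?thesis by (metis mult.commute t.hom_power)
qed

lemma is_unit_tpoly_iff: "(G :: 'a::field tpoly) dvd 1 \<longleftrightarrow> (\<exists>c. c \<noteq> 0 \<and> G = tconst c)"
  by (auto simp: is_unit_poly_iff tconst_def dvd_field_iff elim!: degree_eq_zeroE)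

lemma irreducible_mat_act:
  assumes "invertible M" "irreducible G" shows "irreducible (mat_act M (G :: 'a::field tpoly))"
proof -
  obtain N where N: "M ** N = mat 1" "N ** M = mat 1" using assms(1) by (auto simp: invertible_def)
  interpret M: comm_ring_hom "mat_act M" by (rule comm_ring_hom_mat_act)
  interpret N: comm_ring_hom "mat_act N" by (rule comm_ring_hom_mat_act)
  have MN: "mat_act M (mat_act N H) = H" "mat_act N (mat_act M H) = H" for H
    by (simp_all add: mat_act_mat_act N)
  have unit: "mat_act M H dvd 1 \<longleftrightarrow> H dvd 1" for H
    by (metis M.hom_dvd_1 N.hom_dvd_1 MN(2))
  show ?thesis
  proof (rule irreducibleI)
    show "mat_act M G \<noteq> 0" using assms(2) MN(2)[of G] by (metis N.hom_zero irreducible_def)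
    show "\<not> mat_act M G dvd 1" using assms(2) unit by (simp add: irreducible_def)
    fix A B assume "mat_act M G = A * B"
    then have "G = mat_act N A * mat_act N B" by (metis MN(2) N.hom_mult)
    then have "mat_act N A dvd 1 \<or> mat_act N B dvd 1" using assms(2) irreducibleD by blast
    then show "A dvd 1 \<or> B dvd 1" by (metis MN(1) M.hom_dvd_1)
  qed
qed

subsection \<open>Irreducibility of the two curves\<close>

lemma degree_lead_diff:
  fixes f g :: "'r::ab_group_add poly"
  assumes "degree g < degree f"
  shows "degree (f - g) = degree f" "lead_coeff (f - g) = lead_coeff f"
  using assms by (simp_all add: degree_diff_eq_left coeff_eq_0)

definition semi_invariant :: "'a::field tpoly \<Rightarrow> 'a^3^3 \<Rightarrow> bool" where
  "semi_invariant G M \<longleftrightarrow> (\<exists>k. mat_act M G = tconst k * G)"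

lemma mat_act_tconst: "mat_act M (tconst c * G) = tconst c * mat_act M G"
proof -
  interpret m: comm_ring_hom "mat_act M" by (rule comm_ring_hom_mat_act)
  show ?thesis by (simp add: m.hom_mult) (simp add: mat_act_def)
qed

lemma semi_invariant_mult:
  assumes "semi_invariant G M" "semi_invariant G N"
  shows "semi_invariant G (M ** N)"
proof -
  interpret t: comm_ring_hom "tconst :: 'a \<Rightarrow> _" by (rule comm_ring_hom_tconst)
  obtain k l where "mat_act M G = tconst k * G" "mat_act N G = tconst l * G"
    using assms by (auto simp: semi_invariant_def)
  then have "mat_act (M ** N) G = tconst (k * l) * G"
    by (simp add: mat_act_tconst t.hom_mult mult.assoc flip: mat_act_mat_act)
  then show ?thesis by (auto simp: semi_invariant_def)
qed

lemma lower_block_mult: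
  "lower_block a b c d e f g ** lower_block a' b' c' d' e' f' g' =
    lower_block (a * a' + b * c') (a * b' + b * d') (c * a' + d * c') (c * b' + d * d')
      (e * a' + f * c' + g * e') (e * b' + f * d' + g * f') (g * g')"
  by (simp add: vec_eq_iff forall_3 lower_block_def matrix_matrix_mult_def sum_3)

lemma lower_block_1: "lower_block 1 0 0 1 0 0 1 = mat 1"
  by (simp add: vec_eq_iff forall_3 lower_block_def mat_def)

context alg_closed_char_p
begin

definition eval_at_1_0 :: "'k poly poly \<Rightarrow> 'k" where
  "eval_at_1_0 g = eval_poly (\<lambda>f. eval_poly (\<lambda>c. c) f 1) g 0"

lemma comm_ring_hom_eval_at_1_0: "comm_ring_hom eval_at_1_0"
  unfolding eval_at_1_0_def
  by (rule comm_ring_hom_eval_poly[OF comm_ring_hom_eval_poly[OF comm_ring_hom_id]])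

lemma eval_at_1_0_vars [simp]: "eval_at_1_0 [:[:0, 1:]:] = 1" "eval_at_1_0 [:0, 1:] = 0"
  using comm_ring_hom_id[where 'a='k] by (simp_all add: eval_at_1_0_def comm_ring_hom_eval_poly)

lemma axis_eval_poly: "axis_eval z G = poly (map_poly eval_at_1_0 G) z"
  by (simp add: axis_eval_def tev_def eval_poly_def[of eval_at_1_0, symmetric] flip: eval_at_1_0_def[abs_def])

lemma axis_eval_0: "axis_eval 0 G = eval_at_1_0 (coeff G 0)"
proof -
  interpret l: comm_ring_hom eval_at_1_0 by (rule comm_ring_hom_eval_at_1_0)
  show ?thesis by (simp add: axis_eval_poly poly_0_coeff_0 coeff_map_poly)
qed

abbreviation Q0 :: "'k poly poly" where "Q0 \<equiv> dickson_Q q [:[:0, 1:]:] [:0, 1:]"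
abbreviation D0 :: "'k poly poly" where "D0 \<equiv> dickson_D q [:[:0, 1:]:] [:0, 1:]"

lemma eval_at_1_0_Q0: "eval_at_1_0 Q0 = 1"
  using hom_dickson(2)[OF comm_ring_hom_eval_at_1_0, of q "[:[:0, 1:]:]" "[:0, 1:]"]
  by (simp add: dickson_at_axis eval_at_1_0_vars[simplified])

lemma Q0_nonzero: "Q0 \<noteq> 0"
proof -
  interpret l: comm_ring_hom eval_at_1_0 by (rule comm_ring_hom_eval_at_1_0)
  show ?thesis using eval_at_1_0_Q0 by (metis l.hom_zero zero_neq_one)
qed

lemma dickson_tpoly_const:
  "dickson_Q q varX varY = [:Q0:]" "dickson_D q varX varY = [:D0:]"
  "dickson_phi q varX varY = ([:dickson_phi q [:[:0, 1:]:] [:0, 1:]:] :: 'k tpoly)"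
  using hom_dickson(1-3)[OF comm_ring_hom_const, of q "[:[:0, 1::'k:]:]" "[:0, 1:]"]
  unfolding varXY_eq by simp_all

lemma dickson_N_monic:
  "degree (dickson_N q varX varY (varZ :: 'k tpoly)) = q ^ 2"
  "lead_coeff (dickson_N q varX varY (varZ :: 'k tpoly)) = 1"
proof -
  define phi where "phi = dickson_phi q varX (varZ :: 'k tpoly)"
  have "phi = monom 1 q - monom ([:[:0, 1:]:] ^ (q - 1)) 1"
    by (simp add: phi_def dickson_phi_def varX_def varZ_def monom_altdef poly_const_pow)
  moreover have "degree (monom ([:[:0, 1:]:] ^ (q - 1)) 1 :: 'k tpoly) \<le> 1" by (rule degree_monom_le)
  ultimately have phi: "degree phi = q" "lead_coeff phi = 1"
    using q_gt_1 degree_lead_diff[of "monom ([:[:0, 1:]:] ^ (q - 1)) 1" "monom (1 :: 'k poly poly) q"]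
    by (simp_all add: degree_monom_eq)
  then have phi0: "phi \<noteq> 0" using q_gt_0 by auto
  define c where "c = dickson_phi q [:[:0, 1:]:] [:0, 1::'k poly:]"
  have N: "dickson_N q varX varY varZ = phi ^ q - smult (c ^ (q - 1)) phi"
    unfolding dickson_N_def dickson_tpoly_const phi_def[symmetric] c_def[symmetric]
    by (simp add: poly_const_pow)
  have "degree (phi ^ q) = q ^ 2"
    using phi phi0 by (simp add: degree_power_eq power2_eq_square)
  moreover have "lead_coeff (phi ^ q) = 1" by (simp only: lead_coeff_power phi(2) power_one)
  moreover have "degree (smult (c ^ (q - 1)) phi) < q ^ 2"
    using degree_smult_le[of "c ^ (q - 1)" phi] phi q_gt_1 by (simp add: power2_eq_square le_less_trans)
  ultimately show "degree (dickson_N q varX varY (varZ :: 'k tpoly)) = q ^ 2"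
    "lead_coeff (dickson_N q varX varY (varZ :: 'k tpoly)) = 1"
    unfolding N using degree_lead_diff[of "smult (c ^ (q - 1)) phi" "phi ^ q"] by simp_all
qed

lemma curve_tpoly_lead:
  "degree (curve_tpoly j) = q ^ 2 * (q - 1)" "lead_coeff (curve_tpoly j) = (if j then Q0 else 1)"
proof -
  define N where "N = dickson_N q varX varY (varZ :: 'k tpoly)"
  have pos: "q ^ 2 * (q - 1) > 0" using q_gt_1 by simp
  have N0: "N \<noteq> 0" using dickson_N_monic(2) by (auto simp: N_def)
  have "degree (N ^ (q - 1)) = q ^ 2 * (q - 1)"
    using dickson_N_monic N0 by (simp add: N_def degree_power_eq mult.commute)
  moreover have "lead_coeff (N ^ (q - 1)) = 1"
    using dickson_N_monic(2) by (simp only: lead_coeff_power N_def power_one)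
  moreover have P: "pencil q varX varY (varZ :: 'k tpoly) = N ^ (q - 1) - [:Q0 ^ q:]"
    by (simp add: pencil_def dickson_tpoly_const poly_const_pow N_def)
  ultimately have pen: "degree (pencil q varX varY (varZ :: 'k tpoly)) = q ^ 2 * (q - 1)"
    "lead_coeff (pencil q varX varY (varZ :: 'k tpoly)) = 1"
    using pos degree_lead_diff[of "[:Q0 ^ q:]" "N ^ (q - 1)"] by simp_all
  have C: "curve_tpoly True = smult Q0 (pencil q varX varY varZ) - [:D0 ^ (q * (q - 1)):]"
    by (simp add: curve_def dickson_tpoly_const poly_const_pow)
  have "degree (smult Q0 (pencil q varX varY (varZ :: 'k tpoly))) = q ^ 2 * (q - 1)"
    using pen Q0_nonzero by simp
  then have "degree (curve_tpoly True) = q ^ 2 * (q - 1)" "lead_coeff (curve_tpoly True) = Q0"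
    unfolding C using pen pos Q0_nonzero
      degree_lead_diff[of "[:D0 ^ (q * (q - 1)):]" "smult Q0 (pencil q varX varY varZ)"]
    by (simp_all add: lead_coeff_smult)
  then show "degree (curve_tpoly j) = q ^ 2 * (q - 1)" "lead_coeff (curve_tpoly j) = (if j then Q0 else 1)"
    using pen by (cases j; simp add: curve_def)+
qed

lemma curve_tpoly_nonzero: "curve_tpoly j \<noteq> 0"
  using curve_tpoly_lead(2)[of j] Q0_nonzero by (auto split: if_splits)

lemma axis_eval_0_curve: "axis_eval 0 (curve_tpoly j) \<noteq> 0"
proof -
  have "axis_eval 0 (curve_tpoly j) = curve q j 1 0 0"
    by (simp add: axis_eval_def hom_dickson[OF comm_ring_hom_tev[OF comm_ring_hom_id]] comm_ring_hom_id)
  then show ?thesis using q_gt_1 by (simp add: curve_at_axis[OF CHAR_K] dickson_at_axis power_0_left)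
qed

text \<open>The point (1 : 0 : 0) lies on neither curve.\<close>

lemma coeff_0_factor_nonzero:
  assumes "G dvd curve_tpoly j" shows "coeff G 0 \<noteq> 0"
proof
  interpret l: comm_ring_hom eval_at_1_0 by (rule comm_ring_hom_eval_at_1_0)
  interpret a: comm_ring_hom "axis_eval 0" by (rule comm_ring_hom_axis_eval)
  assume "coeff G 0 = 0"
  then have "axis_eval 0 G = 0" by (simp add: axis_eval_0)
  then show False using assms axis_eval_0_curve by (metis a.hom_dvd dvd_0_left_iff)
qed

text \<open>The leading coefficient of G divides Q or 1, both of value 1 at (1, 0). Hence G keeps
  its degree in Z when restricted to X = 1, Y = 0.\<close>

lemma factor_root:
  assumes "G dvd curve_tpoly j" "degree G > 0"
  obtains z where "axis_eval z G = 0"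
proof -
  interpret l: comm_ring_hom eval_at_1_0 by (rule comm_ring_hom_eval_at_1_0)
  obtain R where R: "curve_tpoly j = G * R" using assms(1) ..
  have "lead_coeff G * lead_coeff R = (if j then Q0 else 1)"
    using curve_tpoly_lead(2)[of j] unfolding R lead_coeff_mult .
  then have "eval_at_1_0 (lead_coeff G) * eval_at_1_0 (lead_coeff R) = 1"
    using eval_at_1_0_Q0 by (metis l.hom_mult l.hom_one)
  then have "coeff (map_poly eval_at_1_0 G) (degree G) \<noteq> 0" by (auto simp: coeff_map_poly)
  then have "degree (map_poly eval_at_1_0 G) > 0" using assms(2) by (metis le_degree less_le_trans)
  then show thesis using alg_closed that by (auto simp: axis_eval_poly)
qed

text \<open>D splits as xy(B - A), and modulo each of x, y and B - A the form Q is a power of x or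
  y. A common prime divisor would divide both variables.\<close>

lemma common_divisor_Q0_D0:
  assumes pr: "prime_elem g" and gQ: "g dvd Q0" and gD: "g dvd D0"
  shows False
proof -
  define x y :: "'k poly poly" where "x = [:[:0, 1:]:]" and "y = [:0, 1:]"
  define A B where "A = x ^ (q - 1)" and "B = y ^ (q - 1)"
  note pd = prime_elem_dvd_power[OF pr]
  have Q: "Q0 = (\<Sum>i\<le>q. A ^ i * B ^ (q - i))" by (simp add: dickson_Q_def A_def B_def x_def y_def)
  have xA: "x dvd A" "y dvd B" using q_gt_1 by (simp_all add: A_def B_def dvd_power)
  have x_y: "g dvd y" if "g dvd x"
  proof -
    have eq: "Q0 = B ^ q + (\<Sum>i<q. A ^ Suc i * B ^ (q - Suc i))"
      unfolding Q by (subst sum.atMost_shift) simp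
    have "g dvd (\<Sum>i<q. A ^ Suc i * B ^ (q - Suc i))"
    proof (rule dvd_sum)
      fix i
      have "A dvd A ^ Suc i * B ^ (q - Suc i)" by simp
      then show "g dvd A ^ Suc i * B ^ (q - Suc i)" using that xA(1) by (meson dvd_trans)
    qed
    then have "g dvd B ^ q" using gQ dvd_add_left_iff unfolding eq by blast
    then show ?thesis using pd unfolding B_def by blast
  qed
  have y_x: "g dvd x" if "g dvd y"
  proof -
    have eq: "Q0 = (\<Sum>i<q. A ^ i * B ^ (q - i)) + A ^ q"
      unfolding Q by (simp flip: lessThan_Suc_atMost)
    have "g dvd (\<Sum>i<q. A ^ i * B ^ (q - i))"
    proof (rule dvd_sum)
      fix i assume "i \<in> {..<q}"
      then have "B dvd B ^ (q - i)" by (simp add: dvd_power)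
      then show "g dvd A ^ i * B ^ (q - i)" using that xA by (meson dvd_mult dvd_trans)
    qed
    then have "g dvd A ^ q" using gQ dvd_add_right_iff unfolding eq by blast
    then show ?thesis using pd unfolding A_def by blast
  qed
  \<comment> \<open>Modulo B - A each of the q + 1 summands of Q is A^q, and q + 1 = 1 in
    characteristic p.\<close>
  have AB: "g dvd x" if "g dvd B - A"
  proof -
    have "g dvd (\<Sum>i\<le>q. A ^ i * B ^ (q - i) - A ^ i * A ^ (q - i))"
    proof (rule dvd_sum)
      fix i
      have "B - A dvd A ^ i * (B ^ (q - i) - A ^ (q - i))" by (simp add: diff_dvd_diff_power)
      then show "g dvd A ^ i * B ^ (q - i) - A ^ i * A ^ (q - i)"
        using that dvd_trans unfolding right_diff_distrib by blast
    qed
    also have "(\<Sum>i\<le>q. A ^ i * B ^ (q - i) - A ^ i * A ^ (q - i)) = Q0 - (\<Sum>i\<le>q. A ^ q)"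
      unfolding Q sum_subtractf by (simp flip: power_add)
    also have "(\<Sum>i\<le>q. A ^ q) = A ^ q"
    proof -
      have "of_nat q = (0 :: 'k poly poly)"
        using CHAR_bpoly expo_pos by (metis q_eq dvd_power of_nat_eq_0_iff_char_dvd less_eq_Suc_le One_nat_def)
      then show ?thesis by simp
    qed
    finally have "g dvd Q0 - A ^ q" .
    then have "g dvd A ^ q" using gQ dvd_diff_right_iff by blast
    then show ?thesis using pd unfolding A_def by blast
  qed
  have "x ^ q = x * A" "y ^ q = y * B" using q_gt_0 by (simp_all add: A_def B_def flip: power_Suc)
  then have "D0 = x * (y * (B - A))"
    unfolding dickson_D_def x_def[symmetric] y_def[symmetric] by (simp add: algebra_simps)
  then have "g dvd x \<or> g dvd y \<or> g dvd B - A" using gD prime_elem_dvd_mult_iff[OF pr] by simp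
  then have "g dvd x" "g dvd y" using x_y y_x AB by blast+
  then have "degree g = 0"
    using dvd_imp_degree_le[of g x] by (simp add: x_def)
  then obtain h where h: "g = [:h:]" by (elim degree_eq_zeroE)
  have "h dvd coeff y 1" using \<open>g dvd y\<close> unfolding h const_poly_dvd_iff by blast
  then have "h dvd 1" by (simp add: y_def)
  then have "g dvd 1" unfolding h by (simp add: is_unit_const_poly_iff)
  then show False using pr by (simp add: prime_elem_def)
qed

text \<open>A factor free of Z divides every coefficient in Z. For the second curve the leading
  coefficient is Q and the constant one is, modulo Q, a power of D up to sign.\<close>

lemma irreducible_factor_degree_pos:
  assumes irr: "irreducible G" and dvd: "G dvd curve_tpoly j"
  shows "degree G > 0"
proof (rule ccontr)
  assume "\<not> degree G > 0"
  then obtain g where g: "G = [:g:]" by (auto elim: degree_eq_zeroE)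
  have gc: "g dvd coeff (curve_tpoly j) i" for i using dvd unfolding g const_poly_dvd_iff by blast
  have lead: "g dvd (if j then Q0 else 1)"
    using gc[of "degree (curve_tpoly j)"] unfolding curve_tpoly_lead(2) .
  show False
  proof (cases j)
    case False
    then have "G dvd 1" using lead by (simp add: g is_unit_const_poly_iff)
    then show False using irr by (simp add: irreducible_def)
  next
    case True
    have "irreducible g" using irr unfolding g by (simp add: irreducible_const_poly_iff)
    then have pr: "prime_elem g" by simp
    have gQ: "g dvd Q0" using lead True by simp
    have "coeff (curve_tpoly j) 0 = curve q j [:[:0, 1:]:] [:0, 1:] 0"
    proof -
      have "poly varX 0 = ([:[:0, 1:]:] :: 'k poly poly)" "poly varY 0 = ([:0, 1:] :: 'k poly poly)"
        "poly varZ 0 = (0 :: 'k poly poly)"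
        by (simp_all add: varX_def varY_def varZ_def)
      then show ?thesis
        by (simp only: poly_0_coeff_0[symmetric] hom_dickson(6)[OF comm_ring_hom_poly])
    qed
    also have "\<dots> = Q0 * (- (Q0 ^ q)) - D0 ^ (q * (q - 1))"
      using True q_gt_1 by (simp add: curve_def pencil_def dickson_N_def dickson_phi_def[of _ _ 0] power_0_left)
    finally have "g dvd Q0 * (- (Q0 ^ q)) - D0 ^ (q * (q - 1))" using gc by metis
    then have "g dvd D0 ^ (q * (q - 1))" using gQ by (metis dvd_diff_right_iff dvd_mult2)
    then have "g dvd D0" using prime_elem_dvd_power[OF pr] by blast
    then show False using common_divisor_Q0_D0[OF pr gQ] by blast
  qed
qed

text \<open>The image of G vanishes at the same z as G, where the cofactor R does not. As a prime
  divisor of G R it divides G, and irreducibility makes the two associated.\<close>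

lemma factor_fixed_by_axis_homologies:
  assumes irr: "irreducible G" and dvd: "G dvd curve_tpoly j" and "s \<in> F" "s \<noteq> 0" "b \<in> F"
  shows "semi_invariant G (lower_block 1 0 0 s 0 b 1)"
proof -
  define M :: "'k^3^3" where "M = lower_block 1 0 0 s 0 b 1"
  have inv: "invertible M" using assms by (simp add: M_def invertible_det_nz det_lower_block)
  interpret m: comm_ring_hom "mat_act M" by (rule comm_ring_hom_mat_act)
  obtain R where R: "curve_tpoly j = G * R" using dvd ..
  obtain z where z: "axis_eval z G = 0"
    using factor_root[OF dvd irreducible_factor_degree_pos[OF irr dvd]] .
  have Rz: "axis_eval z R \<noteq> 0" by (rule curve_cofactor_nonzero[OF R z])
  have ev: "axis_eval z (mat_act M H) = axis_eval z H" for H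
  proof -
    interpret a: comm_ring_hom "tev (\<lambda>c. c) 1 0 z" by (rule comm_ring_hom_tev[OF comm_ring_hom_id])
    show ?thesis
      unfolding M_def mat_act_lower_block xysubst_def axis_eval_def tev_tsubst[OF comm_ring_hom_id]
      by (simp add: a.hom_add a.hom_mult comm_ring_hom_id)
  qed
  have "mat_act M (curve_tpoly j) = curve_tpoly j"
    unfolding M_def mat_act_lower_block using assms by (intro xysubst_curve_tpoly) auto
  then have "mat_act M G dvd G * R" using m.hom_dvd[OF dvd] R by simp
  moreover have irrM: "irreducible (mat_act M G)" using inv irr by (rule irreducible_mat_act)
  then have "prime_elem (mat_act M G)" by simp
  moreover have "\<not> mat_act M G dvd R"
  proof
    interpret a: comm_ring_hom "axis_eval z" by (rule comm_ring_hom_axis_eval)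
    assume "mat_act M G dvd R"
    then have "axis_eval z (mat_act M G) dvd axis_eval z R" by (rule a.hom_dvd)
    then show False using Rz z ev by simp
  qed
  ultimately have "mat_act M G dvd G" by (metis prime_elem_dvd_mult_iff)
  then obtain U where U: "G = mat_act M G * U" ..
  then have "U dvd 1" using irr irrM by (metis irreducibleD irreducible_not_unit)
  then obtain c where c: "c \<noteq> 0" "U = tconst c" by (auto simp: is_unit_tpoly_iff)
  have "mat_act M G = tconst (1 / c) * G"
  proof -
    interpret t: comm_ring_hom "tconst :: 'k \<Rightarrow> _" by (rule comm_ring_hom_tconst)
    have "tconst (1 / c) * G = tconst (1 / c * c) * mat_act M G"
      by (subst U) (simp only: c t.hom_mult mult_ac)
    then show ?thesis using c by (simp add: t.hom_one)
  qed
  then show ?thesis unfolding semi_invariant_def M_def by blast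
qed

lemma hdeg_curve_tpoly:
  "hdeg (curve_tpoly j) (if j then q ^ 3 - q else q ^ 3 - q ^ 2)"
proof -
  have v: "hdeg (varX :: 'k tpoly) 1" "hdeg (varY :: 'k tpoly) 1" "hdeg (varZ :: 'k tpoly) 1"
    by (rule hdeg_vars)+
  have D: "hdeg (dickson_D q varX varY :: 'k tpoly) (1 + q)"
    unfolding dickson_D_def
    using hdeg_mult[OF v(1) hdeg_power[OF v(2), of q]] hdeg_mult[OF hdeg_power[OF v(1), of q] v(2)]
    by (intro hdeg_diff) simp_all
  have Q: "hdeg (dickson_Q q varX varY :: 'k tpoly) (q * (q - 1))"
    unfolding dickson_Q_def
  proof (rule hdeg_sum)
    fix i assume "i \<in> {..q}"
    then have "i * (q - 1) + (q - i) * (q - 1) = q * (q - 1)" by (simp flip: add_mult_distrib)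
    then show "hdeg ((varX ^ (q - 1)) ^ i * (varY ^ (q - 1)) ^ (q - i) :: 'k tpoly) (q * (q - 1))"
      using hdeg_mult[OF hdeg_power[OF hdeg_power[OF v(1), of "q - 1"], of i] hdeg_power[OF hdeg_power[OF v(2), of "q - 1"], of "q - i"]]
      by simp
  qed
  have phi: "hdeg (dickson_phi q varX t :: 'k tpoly) q" if "hdeg t 1" for t
    unfolding dickson_phi_def
    using hdeg_power[OF that, of q] hdeg_mult[OF hdeg_power[OF v(1), of "q - 1"] that] q_gt_0
    by (intro hdeg_diff) simp_all
  have "q + (q - 1) * q = q * q" using q_gt_0 by (cases q) auto
  then have N: "hdeg (dickson_N q varX varY varZ :: 'k tpoly) (q * q)"
    unfolding dickson_N_def
    using hdeg_power[OF phi[OF v(3)], of q] hdeg_mult[OF phi[OF v(3)] hdeg_power[OF phi[OF v(2)], of "q - 1"]]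
    by (intro hdeg_diff) simp_all
  have P: "hdeg (pencil q varX varY varZ :: 'k tpoly) (q * q * (q - 1))"
    unfolding pencil_def
    using hdeg_power[OF N, of "q - 1"] hdeg_power[OF Q, of q]
    by (intro hdeg_diff) (simp_all add: mult_ac)
  obtain r where r: "q = Suc r" using q_gt_0 by (cases q) auto
  have e1: "q * q * (q - 1) = q ^ 3 - q ^ 2"
    by (simp add: r power3_eq_cube power2_eq_square algebra_simps)
  have e2: "q * (q - 1) + q * q * (q - 1) = q ^ 3 - q" "q * (q - 1) * (1 + q) = q ^ 3 - q"
    by (simp_all add: r power3_eq_cube power2_eq_square algebra_simps)
  show ?thesis
  proof (cases j)
    case True
    have "hdeg (dickson_Q q varX varY * pencil q varX varY varZ - dickson_D q varX varY ^ (q * (q - 1)) :: 'k tpoly) (q ^ 3 - q)"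
      using hdeg_mult[OF Q P] hdeg_power[OF D, of "q * (q - 1)"] unfolding e2 by (rule hdeg_diff)
    then show ?thesis using True by (simp add: curve_def)
  next
    case False
    then show ?thesis using P unfolding e1 by (simp add: curve_def)
  qed
qed

lemma factor_axial_invariant:
  assumes irr: "irreducible G" and dvd: "G dvd curve_tpoly j"
  shows "axial_invariant G"
proof -
  define S :: "'k^3^3" where "S = lower_block 0 1 1 0 0 0 1"
  have SS: "S ** S = mat 1" by (simp add: S_def lower_block_mult lower_block_1)
  interpret S: comm_ring_hom "mat_act S" by (rule comm_ring_hom_mat_act)
  have "invertible S" using SS by (auto simp: invertible_def)
  then have irrS: "irreducible (mat_act S G)" using irr by (rule irreducible_mat_act)
  have "mat_act S (curve_tpoly j) = curve_tpoly j"
    unfolding S_def mat_act_lower_block by (intro xysubst_curve_tpoly) auto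
  then have dvdS: "mat_act S G dvd curve_tpoly j" using S.hom_dvd[OF dvd] by simp
  have Y: "semi_invariant G (lower_block 1 0 0 s 0 b 1)" if "s \<in> F" "s \<noteq> 0" "b \<in> F" for s b
    by (rule factor_fixed_by_axis_homologies[OF irr dvd that])
  \<comment> \<open>Exchanging X and Y by S preserves the curve and conjugates the axis Y = 0 into X
    = 0.\<close>
  have X: "semi_invariant G (lower_block s 0 0 1 b 0 1)" if sb: "s \<in> F" "s \<noteq> 0" "b \<in> F" for s b
  proof -
    define T :: "'k^3^3" where "T = lower_block 1 0 0 s 0 b 1"
    obtain k where "mat_act T (mat_act S G) = tconst k * mat_act S G"
      using factor_fixed_by_axis_homologies[OF irrS dvdS sb] by (auto simp: semi_invariant_def T_def)
    then have "mat_act S (mat_act T (mat_act S G)) = tconst k * G"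
      by (simp add: mat_act_tconst) (simp add: mat_act_mat_act SS)
    then have "mat_act ((S ** T) ** S) G = tconst k * G"
      by (simp add: mat_act_mat_act)
    moreover have "(S ** T) ** S = lower_block s 0 0 1 b 0 1"
      by (simp add: S_def T_def lower_block_mult)
    ultimately show ?thesis by (auto simp: semi_invariant_def)
  qed
  have tr: "semi_invariant G (lower_block 1 0 0 1 a b 1)" if "a \<in> F" "b \<in> F" for a b
    using semi_invariant_mult[OF X[of 1 a] Y[of 1 b]] that by (simp add: lower_block_mult)
  \<comment> \<open>Projectively, scaling Z by t is scaling X and Y by 1/t: two homologies, followed
    by a scalar matrix that acts on the factor by homogeneity.\<close>
  have sc: "semi_invariant G (lower_block 1 0 0 1 0 0 t)" if t: "t \<in> F" "t \<noteq> 0" for t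
  proof -
    obtain R where R: "curve_tpoly j = G * R" using dvd ..
    have T: "semi_invariant G (lower_block t 0 0 t 0 0 t)"
      using hdeg_factor_scale[of G R _ t] hdeg_curve_tpoly[of j] curve_tpoly_nonzero[of j]
      by (auto simp: R semi_invariant_def mat_act_lower_block xysubst_def tconst_def)
    have "1 / t \<in> F" "1 / t \<noteq> 0" using t by simp_all
    then have "semi_invariant G (lower_block (1 / t) 0 0 1 0 0 1)" "semi_invariant G (lower_block 1 0 0 (1 / t) 0 0 1)"
      using X Y by simp_all
    then have "semi_invariant G ((lower_block (1 / t) 0 0 1 0 0 1 ** lower_block 1 0 0 (1 / t) 0 0 1)
        ** lower_block t 0 0 t 0 0 t)"
      using T by (intro semi_invariant_mult)
    then show ?thesis using t by (simp add: lower_block_mult)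
  qed
  show ?thesis
    using tr sc coeff_0_factor_nonzero[OF dvd]
    by (intro axial_invariantI) (auto simp: semi_invariant_def mat_act_lower_block)
qed

lemma irreducible_curve_tpoly: "irreducible (curve_tpoly j)"
proof -
  have pos: "q ^ 2 * (q - 1) > 0" using q_gt_1 by simp
  have ex: "\<exists>G. irreducible G \<and> G dvd H" if H: "H \<noteq> 0" "\<not> H dvd 1" for H :: "'k tpoly"
  proof -
    obtain A where A: "mset_factors A H" using mset_factors_exist[OF H] by blast
    then have "A \<noteq> {#}" by auto
    then obtain G where "G \<in># A" by auto
    then show ?thesis using A by (meson mset_factors_imp_dvd mset_factorsD(1))
  qed
  have "\<not> curve_tpoly j dvd 1"
  proof
    assume "curve_tpoly j dvd 1"
    then obtain c where "curve_tpoly j = tconst c" by (auto simp: is_unit_tpoly_iff)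
    then have "degree (curve_tpoly j) = 0" by (simp add: tconst_def)
    then show False using pos by (simp add: curve_tpoly_lead)
  qed
  then obtain G where G: "irreducible G" "G dvd curve_tpoly j"
    using ex curve_tpoly_nonzero by blast
  from G(2) obtain R where R: "curve_tpoly j = G * R" ..
  have nz: "G \<noteq> 0" "R \<noteq> 0" using R curve_tpoly_nonzero[of j] by auto
  have deg: "degree G + degree R = q ^ 2 * (q - 1)"
    using curve_tpoly_lead(1)[of j] nz unfolding R by (simp add: degree_mult_eq)
  moreover have "q ^ 2 * (q - 1) dvd degree G"
    by (rule axial_invariant_degree[OF factor_axial_invariant[OF G]])
  then have "q ^ 2 * (q - 1) \<le> degree G"
    using irreducible_factor_degree_pos[OF G] by (simp add: dvd_imp_le)
  ultimately have R0: "degree R = 0" by simp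
  \<comment> \<open>The cofactor is free of Z, but could still be a form in X and Y; its irreducible
    divisors would divide the curve.\<close>
  have "R dvd 1"
  proof (rule ccontr)
    assume "\<not> R dvd 1"
    then obtain H where H: "irreducible H" "H dvd R" using ex nz by blast
    then have "H dvd curve_tpoly j" using R by simp
    then have "degree H > 0" using H irreducible_factor_degree_pos by blast
    then show False using dvd_imp_degree_le[OF H(2)] nz R0 by simp
  qed
  then show ?thesis unfolding R using G(1)
    by (simp add: irreducible_mult_unit_right)
qed

end

subsection \<open>Binary forms\<close>

lemma hdeg_unique:
  assumes "G \<noteq> 0" "hdeg G d" "hdeg G e" shows "d = e"
proof -
  define k where "k = degree G"
  define j where "j = degree (coeff G k)"
  have "coeff G k \<noteq> 0" using assms(1) by (simp add: k_def)
  then have "coeff (coeff G k) j \<noteq> 0" by (simp add: j_def)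
  then have "tcoeff G (degree (coeff (coeff G k) j)) j k \<noteq> 0" by (simp add: tcoeff_def)
  then show ?thesis using assms(2,3) unfolding hdeg_def by metis
qed

lemma linear_form_not_dvd:
  fixes G L :: "'a::field tpoly"
  assumes "irreducible G" "hdeg G n" "n \<ge> 2" "hdeg L 1" "L dvd G"
  shows False
proof -
  obtain U where U: "G = L * U" using assms(5) ..
  have nz: "G \<noteq> 0" "L \<noteq> 0" using assms(1) U by auto
  have "L dvd 1 \<or> U dvd 1" using assms(1) U by (rule irreducibleD)
  then show False
  proof
    assume "L dvd 1"
    then obtain c where "L = tconst c" by (auto simp: is_unit_tpoly_iff)
    then show False using hdeg_unique[OF nz(2) assms(4)] hdeg_tconst[of c] by force
  next
    assume "U dvd 1"
    then obtain c where "U = tconst c" by (auto simp: is_unit_tpoly_iff)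
    then have "hdeg G (1 + 0)" unfolding U using hdeg_mult[OF assms(4) hdeg_tconst] by blast
    then show False using hdeg_unique[OF nz(1) assms(2)] assms(3) by force
  qed
qed

definition binary_form :: "'a::zero poly poly \<Rightarrow> nat \<Rightarrow> bool" where
  "binary_form g n \<longleftrightarrow> (\<forall>i j. coeff (coeff g j) i \<noteq> 0 \<longrightarrow> i + j = n)"

lemma binary_form_zero: "binary_form g n \<Longrightarrow> i + j \<noteq> n \<Longrightarrow> coeff (coeff g j) i = 0"
  unfolding binary_form_def by blast

lemma binary_form_coeff:
  assumes "hdeg G n" "m + k = n" shows "binary_form (coeff G k) m"
  using assms unfolding hdeg_def tcoeff_def binary_form_def by (metis add_right_cancel)

lemma binary_form_coeff_monom:
  assumes "binary_form g n"
  shows "coeff g j = (if j \<le> n then monom (coeff (coeff g j) (n - j)) (n - j) else 0)"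
proof (rule poly_eqI)
  fix i
  show "coeff (coeff g j) i = coeff (if j \<le> n then monom (coeff (coeff g j) (n - j)) (n - j) else 0) i"
  proof (cases "coeff (coeff g j) i = 0")
    case False
    then have "i + j = n" using assms by (auto simp: binary_form_def)
    then show ?thesis by auto
  qed auto
qed

lemma binary_form_degree: "binary_form g n \<Longrightarrow> degree g \<le> n"
  using binary_form_coeff_monom by (metis degree_le not_le)

lemma var_dvd_binary_form:
  fixes g :: "'a::field poly poly"
  assumes "binary_form g n"
  shows "[:[:0, 1:]:] dvd g \<longleftrightarrow> coeff (coeff g n) 0 = 0"
proof -
  have x: "[:0, 1:] dvd f \<longleftrightarrow> coeff f 0 = 0" for f :: "'a poly"
    using poly_eq_0_iff_dvd[of f 0] by (simp add: poly_0_coeff_0)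
  have "coeff (coeff g j) 0 = 0" if "j \<noteq> n" for j using binary_form_zero[OF assms] that by simp
  then show ?thesis unfolding const_poly_dvd_iff x by metis
qed

text \<open>A root \<eta> of the form at X = 1 gives the factor Y - \<eta>X. If that polynomial is
  constant, the coefficient of Y^n vanishes and X is a factor.\<close>

lemma binary_form_linear_factor:
  fixes g :: "'a::field poly poly"
  assumes AC: "\<And>f::'a poly. degree f > 0 \<Longrightarrow> \<exists>x. poly f x = 0"
    and g: "binary_form g n" "n \<ge> 1"
  shows "[:[:0, 1:]:] dvd g \<or> (\<exists>\<eta>. [:- [:0, \<eta>:], 1:] dvd g)"
proof -
  define c where "c j = coeff (coeff g j) (n - j)" for j
  define u where "u = (\<Sum>j\<le>n. monom (c j) j)"
  have cu: "coeff u j = (if j \<le> n then c j else 0)" for j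
    by (simp add: u_def coeff_sum)
  show ?thesis
  proof (cases "degree u = 0")
    case True
    have "c n = 0" using cu[of n] True g(2) coeff_eq_0[of u n] by simp
    then show ?thesis using var_dvd_binary_form[OF g(1)] by (simp add: c_def)
  next
    case False
    then obtain \<eta> where \<eta>: "poly u \<eta> = 0" using AC[of u] by auto
    have "poly g [:0, \<eta>:] = (\<Sum>j\<le>degree g. coeff g j * [:0, \<eta>:] ^ j)" by (rule poly_altdef)
    also have "\<dots> = (\<Sum>j\<le>n. coeff g j * [:0, \<eta>:] ^ j)"
      using binary_form_degree[OF g(1)] by (intro sum.mono_neutral_left) (auto simp: coeff_eq_0)
    also have "\<dots> = (\<Sum>j\<le>n. monom (c j * \<eta> ^ j) n)"
    proof (rule sum.cong)
      fix j assume j: "j \<in> {..n}"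
      have "[:0, \<eta>:] = monom \<eta> 1" by (simp add: monom_altdef)
      then have "[:0, \<eta>:] ^ j = monom (\<eta> ^ j) j" by (simp add: monom_power)
      moreover have "coeff g j = monom (c j) (n - j)"
        using binary_form_coeff_monom[OF g(1), of j] j by (simp add: c_def)
      ultimately show "coeff g j * [:0, \<eta>:] ^ j = monom (c j * \<eta> ^ j) n"
        using j by (simp add: mult_monom)
    qed simp
    also have "\<dots> = monom (poly u \<eta>) n"
      by (simp add: u_def poly_sum poly_monom monom_hom.hom_sum)
    finally have "poly g [:0, \<eta>:] = 0" by (simp add: \<eta>)
    then show ?thesis by (metis poly_eq_0_iff_dvd)
  qed
qed

lemma coeff_binary_form_at_1:
  assumes "binary_form g n"
  shows "coeff (poly g 1) i = (if i \<le> n then coeff (coeff g (n - i)) i else 0)"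
proof -
  have "coeff (poly g 1) i = (\<Sum>j\<le>degree g. coeff (coeff g j) i)"
    by (simp add: poly_altdef coeff_sum)
  also have "\<dots> = (\<Sum>j\<le>n. coeff (coeff g j) i)"
    using binary_form_degree[OF assms] by (intro sum.mono_neutral_left) (auto simp: coeff_eq_0)
  also have "\<dots> = (\<Sum>j\<le>n. if j = n - i \<and> i \<le> n then coeff (coeff g (n - i)) i else 0)"
    using binary_form_zero[OF assms] by (intro sum.cong) auto
  also have "\<dots> = (if i \<le> n then coeff (coeff g (n - i)) i else 0)" by auto
  finally show ?thesis .
qed

context alg_closed_char_p
begin

lemma linear_change_at_1:
  "poly (bsubst [:[:0, a:], [:b:]:] [:0, 1:] g) 1 = poly g 1 \<circ>\<^sub>p [:b, a::'k:]"
proof -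
  have "(\<lambda>g. poly (bsubst [:[:0, a:], [:b:]:] [:0, 1:] g) 1) = (\<lambda>g. poly g 1 \<circ>\<^sub>p [:b, a:])"
    by (rule bpoly_hom_eqI[OF comm_ring_hom_comp[OF comm_ring_hom_poly comm_ring_hom_bsubst]
          comm_ring_hom_comp[OF comm_ring_hom_pcompose comm_ring_hom_poly]])
      (simp_all only: bsubst_simps, simp_all add: pcompose_pCons)
  then show ?thesis unfolding fun_eq_iff by blast
qed

text \<open>The affine maps x -> ax + b over F_q permute the zeros of h(x) = f_1(x, 1). The form
  f_0, having the same multiplier, is there for rational zeros, where counting points alone gives
  too little.\<close>

lemma binary_form_degree_bound:
  fixes f1 f0 :: "'k poly poly"
  assumes f1: "binary_form f1 e" "e > 0" "f1 \<noteq> 0" and f0: "binary_form f0 n"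
    and inv: "\<And>a b c d. a \<in> F \<Longrightarrow> b \<in> F \<Longrightarrow> c \<in> F \<Longrightarrow> d \<in> F \<Longrightarrow> a * d - b * c \<noteq> 0 \<Longrightarrow>
      \<exists>k. k \<noteq> 0 \<and> bsubst [:[:0, a:], [:b:]:] [:[:0, c:], [:d:]:] f1 = smult [:k:] f1 \<and>
        bsubst [:[:0, a:], [:b:]:] [:[:0, c:], [:d:]:] f0 = smult [:k:] f0"
    and coprime: "\<not> ([:[:0, 1:]:] dvd f1 \<and> [:[:0, 1:]:] dvd f0)"
  shows "q * (q - 1) \<le> e"
proof -
  define h where "h = poly f1 1"
  have ch: "coeff h i = (if i \<le> e then coeff (coeff f1 (e - i)) i else 0)" for i
    unfolding h_def by (rule coeff_binary_form_at_1[OF f1(1)])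
  have deg: "degree h \<le> e" by (rule degree_le) (simp add: ch)
  have h0: "h \<noteq> 0"
  proof
    assume "h = 0"
    have "coeff (coeff f1 j) i = 0" for i j
      using ch[of i] binary_form_zero[OF f1(1), of i j] \<open>h = 0\<close> by (cases "i + j = e") auto
    then have "f1 = 0" by (intro poly_eqI) simp
    then show False using f1(3) by simp
  qed
  have hinv: "\<exists>k. k \<noteq> 0 \<and> h \<circ>\<^sub>p [:b, a:] = smult k h \<and> poly f0 1 \<circ>\<^sub>p [:b, a:] = smult k (poly f0 1)"
    if ab: "a \<in> F" "a \<noteq> 0" "b \<in> F" for a b
  proof -
    obtain k where k: "k \<noteq> 0" "bsubst [:[:0, a:], [:b:]:] [:0, 1:] f1 = smult [:k:] f1"
      "bsubst [:[:0, a:], [:b:]:] [:0, 1:] f0 = smult [:k:] f0"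
      using inv[of a b 0 1] ab by auto
    have "h \<circ>\<^sub>p [:b, a:] = smult k h" "poly f0 1 \<circ>\<^sub>p [:b, a:] = smult k (poly f0 1)"
      using linear_change_at_1[of a b f1] linear_change_at_1[of a b f0]
      unfolding k h_def by simp_all
    then show ?thesis using k(1) by blast
  qed
  have orbit: "poly h (b + r * a) = 0 \<longleftrightarrow> poly h r = 0" if ab: "a \<in> F" "a \<noteq> 0" "b \<in> F" for a b r
  proof -
    obtain k where "k \<noteq> 0" "h \<circ>\<^sub>p [:b, a:] = smult k h" using hinv[OF ab] by blast
    then have "poly h (b + r * a) = k * poly h r" using poly_pcompose[of h "[:b, a:]" r] by simp
    then show ?thesis using \<open>k \<noteq> 0\<close> by simp
  qed
  consider "degree h = 0" | r where "poly h r = 0" "r \<notin> F" | r where "poly h r = 0" "r \<in> F"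
    using alg_closed[of h] by auto
  then show ?thesis
  proof cases
    \<comment> \<open>Here f_1 is a multiple of Y^e, and exchanging the variables would turn it into
      a multiple of X^e.\<close>
    case 1
    have "f1 = monom [:coeff h 0:] e"
    proof (rule poly_eqI, rule poly_eqI)
      fix i j
      show "coeff (coeff f1 j) i = coeff (coeff (monom [:coeff h 0:] e) j) i"
      proof (cases "i + j = e")
        case True
        then have "coeff (coeff f1 j) i = coeff h i" using ch[of i] by auto
        then show ?thesis using True 1 by (cases i) (auto simp: coeff_eq_0)
      next
        case False
        then have "coeff (coeff f1 j) i = 0" using binary_form_zero[OF f1(1)] by simp
        then show ?thesis using False by (cases i) auto
      qed
    qed
    then have m: "f1 = [:[:coeff h 0:]:] * [:0, 1:] ^ e" by (simp add: monom_altdef)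
    interpret b: comm_ring_hom "bsubst [:0, 1:] [:[:0, 1:]:] :: 'k poly poly \<Rightarrow> _"
      by (rule comm_ring_hom_bsubst)
    obtain k where k: "k \<noteq> 0" "bsubst [:0, 1:] [:[:0, 1:]:] f1 = smult [:k:] f1"
      using inv[of 0 1 1 0] by auto
    have "bsubst [:0, 1:] [:[:0, 1:]:] f1 = [:[:coeff h 0:]:] * [:[:0, 1:]:] ^ e"
      by (subst m) (simp only: b.hom_mult b.hom_power bsubst_simps)
    then have "degree (smult [:k:] f1) = 0"
      unfolding k(2) by (simp add: poly_const_pow)
    then have "degree f1 = 0" using k(1) by simp
    moreover have "degree f1 = e"
    proof -
      have "coeff h 0 \<noteq> 0" using h0 1 by (metis degree_0_id coeff_0 leading_coeff_0_iff)
      then show ?thesis unfolding \<open>f1 = monom [:coeff h 0:] e\<close> by (simp add: degree_monom_eq)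
    qed
    ultimately show ?thesis using f1(2) by simp
  next
    \<comment> \<open>A zero outside F_q has a regular orbit under the q(q-1) affine maps.\<close>
    case (2 r)
    have inj: "inj_on (\<lambda>(a, b). b + r * a) ((F - {0}) \<times> F)"
    proof (rule inj_onI)
      fix u v assume uv: "u \<in> (F - {0}) \<times> F" "v \<in> (F - {0}) \<times> F"
        "(case u of (a, b) \<Rightarrow> b + r * a) = (case v of (a, b) \<Rightarrow> b + r * a)"
      obtain a b a' b' where [simp]: "u = (a, b)" "v = (a', b')" by (cases u, cases v)
      have A: "a \<in> F" "b \<in> F" "a' \<in> F" "b' \<in> F" and eq: "b + r * a = b' + r * a'"
        using uv by auto
      have "a = a'"
      proof (rule ccontr)
        assume ne: "a \<noteq> a'"
        have "r * (a - a') = b' - b" using eq by (simp add: algebra_simps)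
        then have "r = (b' - b) / (a - a')" using ne by (simp add: field_simps)
        then show False using 2 A by simp
      qed
      then show "u = v" using eq by simp
    qed
    have "q * (q - 1) = card ((\<lambda>(a, b). b + r * a) ` ((F - {0}) \<times> F))"
      unfolding card_image[OF inj] by (simp add: card_cartesian_product card_F card_Diff_singleton mult.commute)
    also have "\<dots> \<le> card {x. poly h x = 0}"
      using orbit 2 poly_roots_finite[OF h0] by (intro card_mono) auto
    also have "\<dots> \<le> degree h" using h0 by (rule card_poly_roots_bound)
    finally show ?thesis using deg by simp
  next
    \<comment> \<open>All elements of F_q are zeros, and multiplicity q - 1 is wanted at each. As X
      divides f_1, it does not divide f_0; the term of f_0 without X gives x -> tx the multiplier 1,
      so exponents in h are multiples of q - 1.\<close>
    case (3 r)
    have z: "poly h 0 = 0" using orbit[of 1 r 0] 3 by simp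
    have roots: "poly h a = 0" if "a \<in> F" for a using orbit[of 1 a 0] z that by simp
    have "coeff (coeff f1 e) 0 = 0" using z ch[of 0] by (simp add: poly_0_coeff_0)
    then have "\<not> [:[:0, 1:]:] dvd f0" using coprime var_dvd_binary_form[OF f1(1)] by blast
    then have c0: "coeff (poly f0 1) 0 \<noteq> 0"
      using var_dvd_binary_form[OF f0] coeff_binary_form_at_1[OF f0, of 0] by simp
    have hi: "coeff h i = 0" if i: "i < q - 1" for i
    proof (rule ccontr)
      assume ne: "coeff h i \<noteq> 0"
      have "(q - 1) dvd i"
      proof (rule q_minus_1_dvd_exponent)
        fix t assume t: "t \<in> F" "t \<noteq> 0"
        obtain k where k: "h \<circ>\<^sub>p [:0, t:] = smult k h" "poly f0 1 \<circ>\<^sub>p [:0, t:] = smult k (poly f0 1)"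
          using hinv[OF t, of 0] by auto
        have "k * coeff (poly f0 1) 0 = coeff (poly f0 1) 0"
          using arg_cong[OF k(2), of "\<lambda>p. coeff p 0"] by (simp add: pcompose_coeff_0 poly_0_coeff_0)
        then have "k = 1" using c0 by simp
        then have "t ^ i * coeff h i = coeff h i"
          using arg_cong[OF k(1), of "\<lambda>p. coeff p i"] by (simp add: coeff_pcompose_linear)
        then show "t ^ i = 1" using ne by simp
      qed
      then have "i = 0" using i by (auto dest: dvd_imp_le)
      then show False using ne z by (simp add: poly_0_coeff_0)
    qed
    have ord0: "q - 1 \<le> order 0 h"
    proof (rule ccontr)
      assume "\<not> q - 1 \<le> order 0 h"
      have "[:- 0, 1:] ^ order 0 h dvd h" by (rule order_1)
      then obtain g where g: "h = [:- 0, 1:] ^ order 0 h * g" "\<not> [:- 0, 1:] dvd g"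
        using order_decomp[OF h0] by blast
      then have "coeff g 0 \<noteq> 0" by (metis poly_0_coeff_0 poly_eq_0_iff_dvd)
      moreover have "h = monom 1 (order 0 h) * g" using g(1) by (simp add: monom_altdef)
      then have "coeff h (order 0 h) = coeff g 0" by (metis coeff_monom_mult diff_self_eq_0 mult_1 order_refl)
      ultimately show False using hi[of "order 0 h"] \<open>\<not> q - 1 \<le> order 0 h\<close> by simp
    qed
    have ord: "q - 1 \<le> order a h" if aF: "a \<in> F" for a
    proof -
      obtain k where k: "k \<noteq> 0" "h \<circ>\<^sub>p [:- a, 1:] = smult k h" using hinv[of 1 "- a"] aF by auto
      have "[:- 0, 1:] ^ (q - 1) dvd h" using ord0 by (simp only: order_divides) simp
      then have "([:- 0, 1:] ^ (q - 1)) \<circ>\<^sub>p [:- a, 1:] dvd h \<circ>\<^sub>p [:- a, 1:]" by (rule pcompose_hom.hom_dvd)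
      then have "[:- a, 1:] ^ (q - 1) dvd smult k h"
        unfolding k(2) pcompose_hom.hom_power by (simp add: pcompose_pCons)
      then have "[:- a, 1:] ^ (q - 1) dvd h" using k(1) by (simp add: dvd_smult_iff)
      then show ?thesis using h0 by (simp only: order_divides) simp
    qed
    have "q * (q - 1) \<le> (\<Sum>a\<in>F. order a h)" using sum_bounded_below[of F "q - 1" "\<lambda>a. order a h"] ord card_F by simp
    also have "\<dots> \<le> (\<Sum>a | poly h a = 0. order a h)"
      using roots poly_roots_finite[OF h0] by (intro sum_mono2) auto
    also have "\<dots> \<le> degree h" by (rule sum_order_le_degree[OF h0])
    finally show ?thesis using deg by simp
  qed
qed

subsection \<open>Degrees of invariant irreducible curves\<close>

text \<open>An irreducible form of degree at least 2 has no linear factor. This excludes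
  divisibility by Z, and also forms in X and Y alone, which split over K.\<close>

lemma invariant_curve_axial:
  assumes irr: "irreducible G" and hom: "hdeg G n" "n \<ge> 2" and inv: "curve_invariant AGL0 G"
  shows "axial_invariant G" "degree G > 0"
proof -
  have "coeff G 0 \<noteq> 0"
  proof
    assume "coeff G 0 = 0"
    then have "varZ dvd G"
      using poly_eq_0_iff_dvd[of G 0] by (simp add: varZ_def poly_0_coeff_0)
    then show False using linear_form_not_dvd[OF irr hom hdeg_vars(3)] by blast
  qed
  moreover have "\<exists>k. xysubst G 1 0 0 1 a b 1 = tconst k * G" if "a \<in> F" "b \<in> F" for a b
    using curve_invariant_xysubst[OF inv, of 1 0 0 1 a b 1] that by auto
  moreover have "\<exists>k. xysubst G 1 0 0 1 0 0 t = tconst k * G" if "t \<in> F" "t \<noteq> 0" for t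
    using curve_invariant_xysubst[OF inv, of 1 0 0 1 0 0 t] that by auto
  ultimately show "axial_invariant G" by (intro axial_invariantI) auto
  show "degree G > 0"
  proof (rule ccontr)
    assume "\<not> degree G > 0"
    then obtain g where g: "G = [:g:]" by (auto elim: degree_eq_zeroE)
    have "binary_form g n" using binary_form_coeff[OF hom(1), of n 0] by (simp add: g)
    then have "[:[:0, 1:]:] dvd g \<or> (\<exists>\<eta>. [:- [:0, \<eta>:], 1:] dvd g)"
      using hom(2) by (intro binary_form_linear_factor alg_closed) auto
    then show False
    proof (elim disjE exE)
      assume "[:[:0, 1:]:] dvd g"
      then have "varX dvd G" by (simp add: g varX_def)
      then show False using linear_form_not_dvd[OF irr hom hdeg_vars(1)] by blast
    next
      fix \<eta> assume "[:- [:0, \<eta>:], 1:] dvd g"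
      moreover have "varY - tconst \<eta> * varX = [:[:- [:0, \<eta>:], 1:]:]"
        by (simp add: varX_def varY_def tconst_def)
      ultimately have "varY - tconst \<eta> * varX dvd G" by (simp add: g)
      moreover have "hdeg (varY - tconst \<eta> * varX) 1"
        using hdeg_diff[OF hdeg_vars(2) hdeg_mult[OF hdeg_tconst hdeg_vars(1), unfolded add_0]] .
      ultimately show False using linear_form_not_dvd[OF irr hom] by blast
    qed
  qed
qed

lemma xysubst_xy:
  "xysubst G a b c d 0 0 1 = tsubst G [:[:[:0, a:], [:b:]:]:] [:[:[:0, c:], [:d:]:]:] (varZ :: 'k tpoly)"
  by (simp add: xysubst_def tconst_def varX_def varY_def)

lemma axial_invariant_dickson_N_power:
  "axial_invariant (dickson_N q varX varY varZ ^ (q - 1))"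
proof -
  define N where "N = dickson_N q varX varY (varZ :: 'k tpoly)"
  have tr: "N ^ (q - 1) \<circ>\<^sub>p [:[:[:0, a:], [:b:]:], 1:] = N ^ (q - 1)" if "a \<in> F" "b \<in> F" for a b
  proof -
    have "N \<circ>\<^sub>p [:[:[:0, a:], [:b:]:], 1:] = N"
      using xysubst_dickson_N[of 1 0 0 1 a b 1] that
      by (simp add: xysubst_translate N_def tconst_mult)
    then show ?thesis by (simp add: pcompose_hom.hom_power)
  qed
  have sc: "N ^ (q - 1) \<circ>\<^sub>p [:0, [:[:t:]:]:] = N ^ (q - 1)" if "t \<in> F" "t \<noteq> 0" for t
  proof -
    interpret t: comm_ring_hom "tconst :: 'k \<Rightarrow> _" by (rule comm_ring_hom_tconst)
    have "N \<circ>\<^sub>p [:0, [:[:t:]:]:] = tconst t * N"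
      using xysubst_dickson_N[of 1 0 0 1 0 0 t] that by (simp add: xysubst_scale N_def)
    then show ?thesis using F_power_minus_1[OF that]
      by (simp add: pcompose_hom.hom_power power_mult_distrib t.hom_one flip: t.hom_power)
  qed
  show ?thesis
    unfolding axial_invariant_def N_def[symmetric] by (intro conjI ballI impI tr sc)
qed

text \<open>Cancelling the leading term by a multiple of the (q-1)-st power of the norm form leaves
  an axially invariant remainder of smaller degree in Z, hence of degree 0. The two coefficients
  come from one G, so they share their multiplier.\<close>

lemma invariant_curve_minimal_z_degree:
  assumes irr: "irreducible G" and hom: "hdeg G n" "n \<ge> 2" and inv: "curve_invariant AGL0 G"
    and deg: "degree G = q ^ 2 * (q - 1)" and e: "n = degree G + e" "e > 0"
  shows "q * (q - 1) \<le> e"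
proof -
  have pos: "q ^ 2 * (q - 1) > 0" using q_gt_1 by simp
  \<comment> \<open>Here \<open>N\<close> includes the exponent q - 1: it is monic in Z of the same
    degree as G.\<close>
  define N where "N = dickson_N q varX varY (varZ :: 'k tpoly) ^ (q - 1)"
  have N: "axial_invariant N" unfolding N_def by (rule axial_invariant_dickson_N_power)
  have "dickson_N q varX varY (varZ :: 'k tpoly) \<noteq> 0" using dickson_N_monic(2) by auto
  then have Ndeg: "degree N = q ^ 2 * (q - 1)"
    using dickson_N_monic(1) by (simp add: N_def degree_power_eq mult.commute)
  have Nlead: "lead_coeff N = 1"
    using dickson_N_monic(2) by (simp only: N_def lead_coeff_power power_one)
  define f1 where "f1 = coeff G (degree G)"
  define R where "R = G - smult f1 N"
  have axG: "axial_invariant G" by (rule invariant_curve_axial[OF irr hom inv])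
  then have "axial_invariant R"
    using N unfolding axial_invariant_def R_def by (simp add: pcompose_diff pcompose_smult)
  then have dvdR: "q ^ 2 * (q - 1) dvd degree R" by (rule axial_invariant_degree)
  have "degree R \<le> q ^ 2 * (q - 1)"
    unfolding R_def using deg Ndeg degree_smult_le[of f1 N] by (intro degree_diff_le) auto
  moreover have "coeff R (q ^ 2 * (q - 1)) = 0"
    using Nlead unfolding R_def f1_def deg Ndeg by simp
  ultimately have "degree R < q ^ 2 * (q - 1)"
    using pos by (metis coeff_0 degree_0 leading_coeff_0_iff le_neq_implies_less)
  then have "degree R = 0" using dvdR by (meson dvd_imp_le not_le neq0_conv)
  then obtain r where r: "R = [:r:]" by (auto elim: degree_eq_zeroE)
  have G: "G = smult f1 N + [:r:]" using r by (simp add: R_def algebra_simps)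
  have N0: "coeff N 0 = 0"
  proof -
    have v: "poly varX 0 = ([:[:0, 1:]:] :: 'k poly poly)" "poly varY 0 = ([:0, 1:] :: 'k poly poly)"
      "poly varZ 0 = (0 :: 'k poly poly)"
      by (simp_all add: varX_def varY_def varZ_def)
    have "poly (dickson_N q varX varY (varZ :: 'k tpoly)) 0 = 0"
      unfolding hom_dickson(4)[OF comm_ring_hom_poly] v
      using q_gt_0 by (simp add: dickson_N_def dickson_phi_def[of _ _ 0] power_0_left)
    then show ?thesis using q_gt_1 by (simp add: N_def poly_0_coeff_0[symmetric] power_0_left)
  qed
  have f0: "r = coeff G 0" using N0 by (simp add: G)
  have "varX dvd G" if "[:[:0, 1:]:] dvd f1" "[:[:0, 1:]:] dvd r"
  proof -
    have "varX dvd [:f1:]" "varX dvd [:r:]" using that by (simp_all add: varX_def)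
    then have "varX dvd [:f1:] * N + [:r:]" by (intro dvd_add dvd_mult2)
    then show ?thesis by (simp add: G)
  qed
  then have coprime: "\<not> ([:[:0, 1:]:] dvd f1 \<and> [:[:0, 1:]:] dvd r)"
    using linear_form_not_dvd[OF irr hom hdeg_vars(1)] by blast
  show ?thesis
  proof (rule binary_form_degree_bound[OF _ e(2) _ _ _ coprime])
    show "binary_form f1 e" unfolding f1_def by (rule binary_form_coeff[OF hom(1)]) (simp add: e)
    show "binary_form r n" unfolding f0 by (rule binary_form_coeff[OF hom(1)]) simp
    show "f1 \<noteq> 0" using irr by (auto simp: f1_def)
    fix a b c d assume abcd: "a \<in> F" "b \<in> F" "c \<in> F" "d \<in> F" "a * d - b * c \<noteq> 0"
    then have "{a, b, c, d, 0, 0, 1} \<subseteq> F" "(1::'k) \<noteq> 0" by auto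
    then obtain k where k: "k \<noteq> 0" "xysubst G a b c d 0 0 1 = tconst k * G"
      using curve_invariant_xysubst[OF inv _ abcd(5)] by metis
    have "bsubst [:[:0, a:], [:b:]:] [:[:0, c:], [:d:]:] (coeff G i) = smult [:k:] (coeff G i)" for i
      using arg_cong[OF k(2), of "\<lambda>H. coeff H i"]
      unfolding xysubst_xy coeff_tsubst_bsubst tconst_mult by simp
    then show "\<exists>k. k \<noteq> 0 \<and> bsubst [:[:0, a:], [:b:]:] [:[:0, c:], [:d:]:] f1 = smult [:k:] f1 \<and>
        bsubst [:[:0, a:], [:b:]:] [:[:0, c:], [:d:]:] r = smult [:k:] r"
      using k(1) unfolding f0 f1_def by blast
  qed
qed

text \<open>The third relation keeps curves whose degree in Z is a higher multiple of q^2(q-1) out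
  of the gap.\<close>

lemma q_power_identities:
  "q ^ 2 * (q - 1) = q ^ 3 - q ^ 2" "q ^ 3 - q ^ 2 + q * (q - 1) = q ^ 3 - q"
  "q ^ 3 - q \<le> 2 * (q ^ 3 - q ^ 2)" "q ^ 3 - q ^ 2 \<ge> 2" "q ^ 3 - q ^ 2 < q ^ 3 - q"
proof -
  obtain r where r: "q = r + 2" using q_ge_2 by (metis add.commute le_Suc_ex)
  show "q ^ 2 * (q - 1) = q ^ 3 - q ^ 2" "q ^ 3 - q ^ 2 + q * (q - 1) = q ^ 3 - q"
    "q ^ 3 - q \<le> 2 * (q ^ 3 - q ^ 2)" "q ^ 3 - q ^ 2 \<ge> 2" "q ^ 3 - q ^ 2 < q ^ 3 - q"
    by (simp_all add: r power3_eq_cube power2_eq_square algebra_simps)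
qed

lemma degree_spectrum_bounds:
  assumes "n \<in> degree_spectrum AGL0"
  shows "q ^ 3 - q ^ 2 \<le> n" "q ^ 3 - q ^ 2 < n \<Longrightarrow> q ^ 3 - q \<le> n"
proof -
  obtain G :: "'k tpoly" where irr: "irreducible G" and G: "G \<noteq> 0" "hdeg G n" "n \<ge> 2"
    and inv: "curve_invariant AGL0 G"
    using assms by (auto simp: degree_spectrum_def homogeneous_iff_hdeg)
  have "q ^ 2 * (q - 1) dvd degree G" and pos: "degree G > 0"
    using axial_invariant_degree invariant_curve_axial[OF irr G(2,3) inv] by blast+
  then obtain m where m: "degree G = (q ^ 3 - q ^ 2) * m" "m > 0"
    unfolding q_power_identities by (metis dvdE mult_0_right neq0_conv)
  have le: "degree G \<le> n"
  proof -
    define k where "k = degree G"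
    have "coeff G k \<noteq> 0" using G(1) by (simp add: k_def)
    then have "coeff (coeff (coeff G k) (degree (coeff G k))) (degree (coeff (coeff G k) (degree (coeff G k)))) \<noteq> 0"
      by simp
    then have "degree (coeff (coeff G k) (degree (coeff G k))) + degree (coeff G k) + k = n"
      using G(2) unfolding hdeg_def tcoeff_def by blast
    then show ?thesis by (simp add: k_def)
  qed
  have "q ^ 3 - q ^ 2 \<le> degree G" using m by simp
  then show "q ^ 3 - q ^ 2 \<le> n" using le by simp
  assume gt: "q ^ 3 - q ^ 2 < n"
  show "q ^ 3 - q \<le> n"
  proof (cases "m = 1")
    case True
    then have deg: "degree G = q ^ 2 * (q - 1)" using m q_power_identities(1) by simp
    have "q * (q - 1) \<le> n - degree G"
      using gt deg q_power_identities(1)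
      by (intro invariant_curve_minimal_z_degree[OF irr G(2,3) inv deg]) simp_all
    then have "degree G + q * (q - 1) \<le> n" using le by linarith
    then show ?thesis unfolding deg q_power_identities(1,2) .
  next
    case False
    then have "2 * (q ^ 3 - q ^ 2) \<le> degree G" using m by simp
    then show ?thesis using le q_power_identities(3) by simp
  qed
qed

lemma degree_spectrum_attained:
  "q ^ 3 - q ^ 2 \<in> degree_spectrum AGL0" "q ^ 3 - q \<in> degree_spectrum AGL0"
proof -
  have "n \<in> degree_spectrum AGL0" if "n \<ge> 2" "hdeg (curve_tpoly j) n" for n j
    unfolding degree_spectrum_def homogeneous_iff_hdeg
    using that irreducible_curve_tpoly[of j] curve_tpoly_nonzero[of j] curve_tpoly_invariant[of j] by blast
  then show "q ^ 3 - q ^ 2 \<in> degree_spectrum AGL0" "q ^ 3 - q \<in> degree_spectrum AGL0"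
    using q_power_identities hdeg_curve_tpoly[of False] hdeg_curve_tpoly[of True] by auto
qed

subsection \<open>Independence of the fixed point\<close>

text \<open>Conjugation by B carries the stabilizer of e into that of P, and substitution by B
  carries invariant curves back.\<close>

lemma degree_spectrum_conjugate_subset:
  fixes B B' :: "'k^3^3"
  assumes B: "\<forall>i j. B$i$j \<in> F" "\<forall>i j. B'$i$j \<in> F" "B ** B' = mat 1" "B' ** B = mat 1"
    and P: "B *v e = P"
  shows "degree_spectrum (AGLbar q P) \<subseteq> degree_spectrum (AGLbar q e)"
proof
  fix n assume "n \<in> degree_spectrum (AGLbar q P)"
  then obtain G :: "'k tpoly" where n: "n \<ge> 2" and irr: "irreducible G" and G: "hdeg G n"
    and inv: "curve_invariant (AGLbar q P) G"
    by (auto simp: degree_spectrum_def homogeneous_iff_hdeg)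
  have invB: "invertible B" using B by (auto simp: invertible_def)
  have irrB: "irreducible (mat_act B G)" using invB irr by (rule irreducible_mat_act)
  have "curve_invariant (AGLbar q e) (mat_act B G)"
    unfolding curve_invariant_def
  proof
    fix M assume M: "M \<in> AGLbar q e"
    define X where "X = B ** M ** B'"
    have "X \<in> AGLbar q P"
    proof -
      have MF: "\<forall>i j. M$i$j \<in> F" and invM: "invertible M" using M by (auto simp: AGLbar_def)
      obtain c where c: "M *v e = c *s e" using M by (auto simp: AGLbar_def)
      have "\<forall>i j. X$i$j \<in> F"
        using B MF by (simp add: X_def matrix_matrix_mult_def sum_3)
      moreover have "invertible X"
        unfolding X_def using invB invM B by (intro invertible_mult) (auto simp: invertible_def)
      moreover have "X *v P = c *s P"
      proof -
        have "B' *v P = e" unfolding P[symmetric] matrix_vector_mul_assoc B(4) by simp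
        then have "X *v P = B *v (M *v e)" by (simp add: X_def flip: matrix_vector_mul_assoc)
        also have "\<dots> = c *s (B *v e)" unfolding c by (simp add: vector_scalar_commute)
        finally show ?thesis unfolding P .
      qed
      ultimately show ?thesis unfolding AGLbar_def by blast
    qed
    then obtain c where c: "c \<noteq> 0" "mat_act X G = tconst c * G" using inv by (auto simp: curve_invariant_def)
    have "X ** B = B ** M" unfolding X_def by (simp add: B(4) flip: matrix_mul_assoc)
    then have "mat_act M (mat_act B G) = mat_act B (mat_act X G)" by (simp add: mat_act_mat_act)
    also have "\<dots> = tconst c * mat_act B G" unfolding c by (rule mat_act_tconst)
    finally show "\<exists>c. c \<noteq> 0 \<and> mat_act M (mat_act B G) = tconst c * mat_act B G" using c(1) by blast
  qed
  then show "n \<in> degree_spectrum (AGLbar q e)"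
    unfolding degree_spectrum_def homogeneous_iff_hdeg
    using n irrB hdeg_mat_act[OF G, of B] by auto
qed

lemma degree_spectrum_conjugate:
  fixes B B' :: "'k^3^3"
  assumes B: "\<forall>i j. B$i$j \<in> F" "\<forall>i j. B'$i$j \<in> F" "B ** B' = mat 1" "B' ** B = mat 1"
    and P: "B *v e = P"
  shows "degree_spectrum (AGLbar q P) = degree_spectrum (AGLbar q e)"
proof -
  have "B' *v P = e" unfolding P[symmetric] matrix_vector_mul_assoc B(4) by simp
  then show ?thesis
    using degree_spectrum_conjugate_subset[OF B P] degree_spectrum_conjugate_subset[OF B(2,1,4,3)] by blast
qed

lemma degree_spectrum_AGLbar:
  fixes P :: "'k^3"
  assumes "P \<noteq> 0" "\<forall>i. P$i \<in> F"
  shows "degree_spectrum (AGLbar q P) = degree_spectrum AGL0"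
proof -
  consider "P$1 \<noteq> 0" | "P$2 \<noteq> 0" | "P$3 \<noteq> 0"
    using assms(1) by (auto simp: vec_eq_iff forall_3)
  \<comment> \<open>P is the third column of B, completed by two coordinate vectors according to a
    nonzero coordinate of P.\<close>
  then have "\<exists>B B' :: 'k^3^3. (\<forall>i j. B$i$j \<in> F) \<and> (\<forall>i j. B'$i$j \<in> F) \<and> B ** B' = mat 1 \<and> B' ** B = mat 1
    \<and> B *v axis 3 1 = P"
  proof cases
    case 1
    show ?thesis
      by (rule exI[of _ "vector [vector [0, 0, P$1], vector [1, 0, P$2], vector [0, 1, P$3]]"],
          rule exI[of _ "vector [vector [- P$2 / P$1, 1, 0], vector [- P$3 / P$1, 0, 1], vector [1 / P$1, 0, 0]]"])
        (use 1 assms(2) in \<open>simp add: forall_3 vec_eq_iff matrix_matrix_mult_def matrix_vector_mult_def sum_3 mat_def axis_def\<close>)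
  next
    case 2
    show ?thesis
      by (rule exI[of _ "vector [vector [1, 0, P$1], vector [0, 0, P$2], vector [0, 1, P$3]]"],
          rule exI[of _ "vector [vector [1, - P$1 / P$2, 0], vector [0, - P$3 / P$2, 1], vector [0, 1 / P$2, 0]]"])
        (use 2 assms(2) in \<open>simp add: forall_3 vec_eq_iff matrix_matrix_mult_def matrix_vector_mult_def sum_3 mat_def axis_def\<close>)
  next
    case 3
    show ?thesis
      by (rule exI[of _ "vector [vector [1, 0, P$1], vector [0, 1, P$2], vector [0, 0, P$3]]"],
          rule exI[of _ "vector [vector [1, 0, - P$1 / P$3], vector [0, 1, - P$2 / P$3], vector [0, 0, 1 / P$3]]"])
        (use 3 assms(2) in \<open>simp add: forall_3 vec_eq_iff matrix_matrix_mult_def matrix_vector_mult_def sum_3 mat_def axis_def\<close>)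
  qed
  then show ?thesis using degree_spectrum_conjugate by blast
qed

lemma epsG_AGLbar:
  fixes P :: "'k^3"
  assumes "P \<noteq> 0" "\<forall>i. P$i \<in> F"
  shows "epsG (AGLbar q P) = int q ^ 2 - int q"
proof -
  note spec = degree_spectrum_AGLbar[OF assms]
  have d: "dG (AGLbar q P) = q ^ 3 - q ^ 2"
    unfolding dG_def spec by (rule Least_equality) (use degree_spectrum_attained degree_spectrum_bounds in blast)+
  have d': "dG' (AGLbar q P) = q ^ 3 - q"
    unfolding dG'_def d unfolding spec
    by (rule Least_equality) (use degree_spectrum_attained degree_spectrum_bounds q_power_identities(5) in blast)+
  have "q ^ 2 \<le> q ^ 3" "q \<le> q ^ 3"
    using power_increasing[of 2 3 q] power_increasing[of 1 3 q] q_gt_1 by simp_all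
  then show ?thesis by (simp add: epsG_def d d' of_nat_diff)
qed

end

theorem mainTheorem5:
  fixes p q n :: nat and P :: "'k::field ^ 3"
  assumes "prime p" and "n \<ge> 1" and "q = p ^ n"
    and "of_nat p = (0::'k)"
    and "\<forall>f::'k poly. degree f > 0 \<longrightarrow> (\<exists>x. poly f x = 0)"
    and "\<forall>x::'k. \<exists>f. f \<noteq> 0 \<and> (\<forall>i. coeff f i \<in> Fq q) \<and> poly f x = 0"
    and "P \<noteq> 0" and "\<forall>i. P $ i \<in> Fq q"
  shows "epsG (AGLbar q P) = int q ^ 2 - int q"
proof -
  interpret alg_closed_char_p p n q "TYPE('k)"
    using assms(1-5) by unfold_locales auto
  show ?thesis using assms(7,8) by (rule epsG_AGLbar)
qed

end
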